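(* Let $\varepsilon>0$. Under Assumptions (1)–(5) listed in the context, let $\{x^k,y^k,z^k\}$ be generated by the damped proximal augmented Lagrangian method (DPALM) described in the context, with $$\beta_k=\beta_0\sqrt{k+1},\qquad v_k=\frac{v_0}{\sqrt{k+1}\,(\log(k+1))^2}\quad (k\ge 1)$$ for some $\beta_0>0$, $v_0>0$ (which are also the values at $k=0$), and such that for all $k\ge0$ $$\operatorname{dist}\big(0,\partial_x\widetilde{\mathcal L}_{\beta_k}(x^{k+1};y^k,z^k)\big)\le\varepsilon_k:=\min\Big\{\frac{\varepsilon}{8},\sqrt{\frac{\rho}{2\beta_k}},1\Big\}.$$ Then for some $k<K:=K_1+K_2$, $x^{k+1}$ is an $\varepsilon$-KKT point of problem (P), where $$K_1:=\Big\lceil\max\Big\{\frac{C_p^2}{\beta_0^2\varepsilon^2},\frac{(4B_p^2+5C_p^2)^2}{16\beta_0^2\varepsilon^2}\Big\}\Big\rceil,\qquad K_2:=\lceil 5C_x\rho\,\varepsilon^{-2}\rceil,$$ and $B_p,C_p,C_x$ are the constants defined in the context.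
   Context: Problem (P): $\min_{x\in\mathbb R^d}F(x):=f(x)+h(x)$ subject to $Ax=b$, $g(x):=[g_1(x),\dots,g_m(x)]\le 0$, where $A\in\mathbb R^{n\times d}$, $b\in\mathbb R^n$, and $F$ is continuous on its domain $\mathcal X:=\mathrm{dom}(F)$. $\|\cdot\|$ is the Euclidean (spectral, for matrices) norm; $[a]_+$ is the componentwise positive part; $\log$ is natural. Assumptions. (1) $\mathcal X$ is compact with diameter $D=\max_{x_1,x_2\in\mathcal X}\|x_1-x_2\|$; $f$ is $\rho$-weakly convex on $\mathcal X$ for some $\rho>0$ (i.e. $f+\frac\rho2\|\cdot\|^2$ is convex); $h$ is closed convex and admits an efficient proximal mapping. (2) Each $g_i:\mathbb R^d\to\mathbb R$ is convex and $L_g$-smooth (gradient $L_g$-Lipschitz) on an open set containing $\mathcal X$. (3) There is $x_{\rm feas}\in\mathrm{int}(\mathcal X)$ with $Ax_{\rm feas}=b$ and $g_{\min}:=\min_{i}-g_i(x_{\rm feas})>0$. (4) There is $r_h>0$ with $\emptyset\ne\partial h(x)\subseteq\mathcal N_{\mathcal X}(x)+\{u:\|u\|\le r_h\}$ for all $x\in\mathcal X$ ($\mathcal N_{\mathcal X}$ is the normal cone). (5) $f$ is $L_f$-smooth on an open set containing $\mathcal X$. $B_g>0$ is a constant with $\max\{|g_i(x)|,\|\nabla g_i(x)\|\}\le B_g$ and $|g_i(x)-g_i(\tilde x)|\le B_g\|x-\tilde x\|$ for all $x,\tilde x\in\mathcal X$, $i\in[m]$; $B_f>0$ is a constant with $\|\nabla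 f(x)\|\le B_f$ on $\mathcal X$. For a $\rho$-weakly convex $\psi$, $\partial\psi(x):=\partial(\psi+\frac\rho2\|\cdot\|^2)(x)-\rho x$, the right-hand subdifferential being the usual convex one. Augmented Lagrangian: $\mathcal L_\beta(x;y,z)=F(x)+y^\top(Ax-b)+\frac\beta2\|Ax-b\|^2+\frac\beta2\|[g(x)+\frac z\beta]_+\|^2-\frac{\|z\|^2}{2\beta}$. DPALM: choose $x^0\in\mathcal X$, $y^0\in\mathrm{Range}(A)$, $z^0\ge0$. For $k=0,1,\dots$: let $x^{k+1}$ be an approximate minimizer of $\widetilde{\mathcal L}_{\beta_k}(x;y^k,z^k):=\mathcal L_{\beta_k}(x;y^k,z^k)+\rho\|x-x^k\|^2$; set $y^{k+1}=y^k+\alpha_k(Ax^{k+1}-b)$, $z^{k+1}=z^k+\alpha_k\max\{-z^k/\beta_k,\,g(x^{k+1})\}$ (componentwise max), with $\alpha_k=\min\big\{\beta_k,\ v_k/\sqrt{\|Ax^{k+1}-b\|^2+\|[g(x^{k+1})]_+\|^2}\big\}$ and the convention $v/0=+\infty$ for $v>0$. $\varepsilon$-KKT point: $x\in\mathcal X$ for which there exist $y\in\mathbb R^n$, $z\in\mathbb R^m_+$ with $\max\{\operatorname{dist}(0,\partial F(x)+J_g(x)^\top z+A^\top y),\ \sqrt{\|Ax-b\|^2+\|[g(x)]_+\|^2},\ \sum_{i=1}^m|z_ig_i(x)|\}\le\varepsilon$ ($J_g$ is the Jacobian of $g$). Constants ($\lambda_{\min}^+$ = smallest positive eigenvalue,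 $\mathrm{bd}$ = boundary, $\dagger$ = pseudoinverse): $\tau=\min\{\frac{g_{\min}}{2\sqrt mB_g},\operatorname{dist}(x_{\rm feas},\mathrm{bd}(\mathcal X))\}$; $\overline B=D(r_h+B_f)+2\rho D^2+D+\tau(1+r_h+B_f+2\rho D)$; $\theta=\overline B/\min\{\tau\sqrt{\lambda_{\min}^+(AA^\top)},\frac{g_{\min}}2\}$; $B_p=\max\{\|(y^0,z^0)\|,\theta\}$; $Q=D(B_f+2\rho D+r_h)$; $C_1=\frac1D+\frac1{\operatorname{dist}(x_{\rm feas},\mathrm{bd}(\mathcal X))}+\frac{B_g}{g_{\min}}$; $\widehat C_p=2\Big(B_p+\sqrt{\frac{Q^2}{g_{\min}^2}+Q^2\|(AA^\top)^\dagger A\|^2C_1^2}\Big)+1$; $C_p=2\widehat C_p$; $C_x=2\max_{x\in\mathcal X}|F(x)|+\frac1{4\beta_0}(14C_p^2+8B_pC_p+7B_p^2)+(10C_p+4B_p)\frac{v_0}{\beta_0}+\frac{\beta_0}2\big(\|Ax^0-b\|^2+\|[g(x^0)+\frac{z^0}{\beta_0}]_+\|^2\big)+|\langle y^0,Ax^0-b\rangle|$. *)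

theory Defs
  imports "HOL-Analysis.Analysis"
begin

definition edom :: "('a \<Rightarrow> ereal) \<Rightarrow> 'a set" where
  "edom \<phi> = {x. \<phi> x < \<infinity>}"

definition eepigraph :: "('a \<Rightarrow> ereal) \<Rightarrow> ('a \<times> real) set" where
  "eepigraph \<phi> = {(x, t). \<phi> x \<le> ereal t}"

text \<open>Values in the reals together with \<open>+\<infinity>\<close>; closed means lower semicontinuous,
  that is, with closed epigraph.\<close>

definition closed_convex_fun :: "('a::euclidean_space \<Rightarrow> ereal) \<Rightarrow> bool" where
  "closed_convex_fun \<phi> \<longleftrightarrow>
     (\<forall>x. \<phi> x \<noteq> - \<infinity>) \<and> closed (eepigraph \<phi>) \<and> convex (eepigraph \<phi>)"

definition subdiff :: "('a::euclidean_space \<Rightarrow> ereal) \<Rightarrow> 'a \<Rightarrow> 'a set" where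
  "subdiff \<phi> x = {v. \<bar>\<phi> x\<bar> \<noteq> \<infinity> \<and> (\<forall>u. \<phi> x + ereal (v \<bullet> (u - x)) \<le> \<phi> u)}"

definition wc_subdiff :: "real \<Rightarrow> ('a::euclidean_space \<Rightarrow> ereal) \<Rightarrow> 'a \<Rightarrow> 'a set" where
  "wc_subdiff \<rho> \<psi> x =
     (\<lambda>v. v - \<rho> *\<^sub>R x) ` subdiff (\<lambda>u. \<psi> u + ereal (\<rho> / 2 * (norm u)\<^sup>2)) x"

definition weakly_convex_on :: "real \<Rightarrow> 'a::euclidean_space set \<Rightarrow> ('a \<Rightarrow> real) \<Rightarrow> bool" where
  "weakly_convex_on \<rho> S \<phi> \<longleftrightarrow> convex_on S (\<lambda>x. \<phi> x + \<rho> / 2 * (norm x)\<^sup>2)"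

definition normal_cone :: "'a::euclidean_space set \<Rightarrow> 'a \<Rightarrow> 'a set" where
  "normal_cone S x = {v. \<forall>u\<in>S. v \<bullet> (u - x) \<le> 0}"

text \<open>Unlike \<^const>\<open>infdist\<close>, the distance to the empty set is \<open>\<infinity>\<close> here; this matters for
  points with empty subdifferential.\<close>

definition dist_set :: "'a::metric_space \<Rightarrow> 'a set \<Rightarrow> ereal" where
  "dist_set a S = (INF s\<in>S. ereal (dist a s))"

definition grad :: "('a::euclidean_space \<Rightarrow> real) \<Rightarrow> 'a \<Rightarrow> 'a" where
  "grad \<phi> x = (THE v. GDERIV \<phi> x :> v)"

definition smooth_on :: "real \<Rightarrow> 'a::euclidean_space set \<Rightarrow> ('a \<Rightarrow> real) \<Rightarrow> bool" where
  "smooth_on L U \<phi> \<longleftrightarrow> (\<forall>x\<in>U. \<phi> differentiable (at x)) \<and> L-lipschitz_on U (grad \<phi>)"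

definition mat_norm :: "real^'d^'n \<Rightarrow> real" where
  "mat_norm M = onorm ((*v) M)"

text \<open>The Moore--Penrose pseudoinverse, characterised by the four Penrose equations.\<close>

definition pinv :: "real^'d^'n \<Rightarrow> real^'n^'d" where
  "pinv M = (THE P. M ** P ** M = M \<and> P ** M ** P = P \<and>
               transpose (M ** P) = M ** P \<and> transpose (P ** M) = P ** M)"

definition pos_eigenvalues :: "real^'n^'n \<Rightarrow> real set" where
  "pos_eigenvalues M = {l. l > 0 \<and> (\<exists>v. v \<noteq> 0 \<and> M *v v = l *\<^sub>R v)}"

definition lambda_min_pos :: "real^'n^'n \<Rightarrow> real" where
  "lambda_min_pos M = Min (pos_eigenvalues M)"

definition pos_part :: "real^'m \<Rightarrow> real^'m" where
  "pos_part a = (\<chi> i. max (a $ i) 0)"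

definition aug_lag ::
  "(real^'d \<Rightarrow> ereal) \<Rightarrow> real^'d^'n \<Rightarrow> real^'n \<Rightarrow> (real^'d \<Rightarrow> real^'m) \<Rightarrow> real \<Rightarrow>
   real^'d \<Rightarrow> real^'n \<Rightarrow> real^'m \<Rightarrow> ereal" where
  "aug_lag F A b g \<beta> x y z = F x + ereal
     (y \<bullet> (A *v x - b) + \<beta> / 2 * (norm (A *v x - b))\<^sup>2
      + \<beta> / 2 * (norm (pos_part (g x + (1 / \<beta>) *\<^sub>R z)))\<^sup>2 - (norm z)\<^sup>2 / (2 * \<beta>))"

definition prox_aug_lag ::
  "(real^'d \<Rightarrow> ereal) \<Rightarrow> real^'d^'n \<Rightarrow> real^'n \<Rightarrow> (real^'d \<Rightarrow> real^'m) \<Rightarrow> real \<Rightarrow> real \<Rightarrow>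
   real^'d \<Rightarrow> real^'d \<Rightarrow> real^'n \<Rightarrow> real^'m \<Rightarrow> ereal" where
  "prox_aug_lag F A b g \<rho> \<beta> xk x y z =
     aug_lag F A b g \<beta> x y z + ereal (\<rho> * (norm (x - xk))\<^sup>2)"

definition infeas :: "real^'d^'n \<Rightarrow> real^'n \<Rightarrow> (real^'d \<Rightarrow> real^'m) \<Rightarrow> real^'d \<Rightarrow> real" where
  "infeas A b g x = sqrt ((norm (A *v x - b))\<^sup>2 + (norm (pos_part (g x)))\<^sup>2)"

text \<open>The case distinction implements \<open>v / 0 = +\<infinity>\<close>.\<close>

definition damped_step :: "real \<Rightarrow> real \<Rightarrow> real \<Rightarrow> real" where
  "damped_step \<beta> v r = (if r = 0 then \<beta> else min \<beta> (v / r))"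

text \<open>The tolerances \<open>eps k\<close> quantify the inexact minimisation in the primal step; a finite
  distance forces the subdifferential to be nonempty, so \<open>x (Suc k)\<close> lies in the domain of \<open>F\<close>.\<close>

definition dpalm ::
  "(real^'d \<Rightarrow> ereal) \<Rightarrow> real^'d^'n \<Rightarrow> real^'n \<Rightarrow> (real^'d \<Rightarrow> real^'m) \<Rightarrow> real \<Rightarrow>
   (nat \<Rightarrow> real) \<Rightarrow> (nat \<Rightarrow> real) \<Rightarrow> (nat \<Rightarrow> real) \<Rightarrow>
   (nat \<Rightarrow> real^'d) \<Rightarrow> (nat \<Rightarrow> real^'n) \<Rightarrow> (nat \<Rightarrow> real^'m) \<Rightarrow> bool" where
  "dpalm F A b g \<rho> \<beta> v eps x y z \<longleftrightarrow>
     x 0 \<in> edom F \<and> y 0 \<in> range ((*v) A) \<and> (\<forall>i. 0 \<le> z 0 $ i) \<and>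
     (\<forall>k. dist_set 0 (wc_subdiff \<rho> (\<lambda>u. prox_aug_lag F A b g \<rho> (\<beta> k) (x k) u (y k) (z k))
                        (x (Suc k))) \<le> ereal (eps k)) \<and>
     (\<forall>k. let \<alpha> = damped_step (\<beta> k) (v k) (infeas A b g (x (Suc k))) in
        y (Suc k) = y k + \<alpha> *\<^sub>R (A *v x (Suc k) - b) \<and>
        z (Suc k) = z k + \<alpha> *\<^sub>R (\<chi> i. max (- (z k $ i) / \<beta> k) (g (x (Suc k)) $ i)))"

definition eps_kkt ::
  "(real^'d \<Rightarrow> ereal) \<Rightarrow> real^'d^'n \<Rightarrow> real^'n \<Rightarrow> (real^'d \<Rightarrow> real^'m) \<Rightarrow> real \<Rightarrow> real \<Rightarrow>
   real^'d \<Rightarrow> bool" where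
  "eps_kkt F A b g \<rho> \<epsilon> x \<longleftrightarrow> x \<in> edom F \<and>
     (\<exists>y z. (\<forall>i. 0 \<le> z $ i) \<and>
        max (dist_set 0 ((\<lambda>v. v + transpose (jacobian g (at x)) *v z + transpose A *v y) ` wc_subdiff \<rho> F x))
          (ereal (max (infeas A b g x) (\<Sum>i\<in>UNIV. \<bar>z $ i * g x $ i\<bar>))) \<le> ereal \<epsilon>)"

text \<open>If \<open>A = 0\<close> then \<open>A A\<^sup>T\<close> has no positive eigenvalue, the minimum over the empty set
  is read as \<open>+\<infinity>\<close>, and only \<open>g\<^sub>m\<^sub>i\<^sub>n / 2\<close> remains in the denominator.\<close>

definition dual_bound :: "real^'d^'n \<Rightarrow> real \<Rightarrow> real \<Rightarrow> real \<Rightarrow> real" where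
  "dual_bound A \<tau> gmin Bbar =
     Bbar / (if A = 0 then gmin / 2
             else min (\<tau> * sqrt (lambda_min_pos (A ** transpose A))) (gmin / 2))"

end

theory Submission
  imports Defs
begin

text \<open>
  Let \<open>P\<^sub>k = (Y\<^sub>k, Z\<^sub>k)\<close> be the undamped multiplier update of \<open>p\<^sub>k = (y\<^sub>k, z\<^sub>k)\<close>, so that \<open>p\<^sub>k\<^sub>+\<^sub>1\<close> is a
  convex combination of \<open>p\<^sub>k\<close> and \<open>P\<^sub>k\<close>. If \<open>P\<^sub>k\<close> is longer than \<open>p\<^sub>k\<close>, then
  \<open>\<langle>P\<^sub>k, P\<^sub>k - p\<^sub>k\<rangle> \<ge> 0\<close>, and testing the approximate stationarity at the Slater point, shifted by
  \<open>\<tau>\<close> against \<open>A\<^sup>T Y\<^sub>k\<close>, bounds \<open>P\<^sub>k\<close> by \<open>\<theta>\<close>. Hence \<open>p\<^sub>k\<close> and \<open>P\<^sub>k\<close> both stay in the ball of radius \<open>B\<^sub>p\<close>;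
  the bound \<open>C\<^sub>p\<close> enters only through \<open>C\<^sub>p \<ge> 4 B\<^sub>p + 2\<close>. Consequently infeasibility and
  complementarity are of order \<open>1 / \<beta>\<^sub>k\<close>, hence at most \<open>\<epsilon>\<close> once \<open>k \<ge> K\<^sub>1\<close>, and only the
  step length \<open>\<parallel>x\<^sub>k\<^sub>+\<^sub>1 - x\<^sub>k\<parallel>\<close> remains to be controlled. A long step decreases the augmented Lagrangian
  by a multiple of \<open>\<epsilon>\<^sup>2 / \<rho>\<close>, whereas changing the multipliers and the penalty increases it by at
  most \<open>O (1 / \<beta>\<^sub>k - 1 / \<beta>\<^sub>k\<^sub>+\<^sub>1) + O (v\<^sub>k / \<beta>\<^sub>k)\<close>, which is summable. Starting the telescoping
  sum at \<open>K\<^sub>1\<close>, it is impossible that all of the next \<open>K\<^sub>2\<close> steps are long.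
\<close>

subsection \<open>Subgradients, spectra and elementary estimates\<close>

lemma has_derivative_ge_directional:
  fixes S :: "'a::euclidean_space \<Rightarrow> real"
  assumes S: "(S has_derivative (\<lambda>d. d \<bullet> s)) (at x)"
    and le: "\<And>t. 0 < t \<Longrightarrow> t < 1 \<Longrightarrow> S x + t * c \<le> S (x + t *\<^sub>R d)"
  shows "c \<le> s \<bullet> d"
proof -
  have line: "((\<lambda>t. x + t *\<^sub>R d) has_derivative (\<lambda>t. t *\<^sub>R d)) (at (0::real))"
    by (auto intro!: derivative_eq_intros)
  have "((\<lambda>t. S (x + t *\<^sub>R d)) has_derivative (\<lambda>t. (t *\<^sub>R d) \<bullet> s)) (at 0)"
    by (rule has_derivative_compose[OF line]) (use S in simp)
  then have "((\<lambda>t. S (x + t *\<^sub>R d)) has_real_derivative (s \<bullet> d)) (at 0)"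
    unfolding has_field_derivative_def
    by (rule has_derivative_eq_rhs) (simp add: fun_eq_iff inner_commute)
  then have "((\<lambda>t. (S (x + t *\<^sub>R d) - S x) / t) \<longlongrightarrow> s \<bullet> d) (at 0)"
    by (simp add: DERIV_def)
  \<comment> \<open>The hypothesis controls the quotient only for \<open>t > 0\<close>;
    differentiability makes the right-hand limit equal to the full one.\<close>
  then have "((\<lambda>t. (S (x + t *\<^sub>R d) - S x) / t) \<longlongrightarrow> s \<bullet> d) (at_right 0)"
    by (rule tendsto_mono[OF at_le, rotated]) simp
  moreover have "\<forall>\<^sub>F t in at_right (0::real). c \<le> (S (x + t *\<^sub>R d) - S x) / t"
    unfolding eventually_at_right_field
  proof (intro exI[of _ 1] conjI allI impI)
    fix t :: real assume "0 < t" "t < 1"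
    then show "c \<le> (S (x + t *\<^sub>R d) - S x) / t"
      using le[of t] by (simp add: field_simps)
  qed simp
  ultimately show ?thesis
    by (rule tendsto_lowerbound) simp
qed

lemma convex_on_above_gradient:
  fixes \<phi> :: "'a::euclidean_space \<Rightarrow> real"
  assumes "convex_on S \<phi>" "x \<in> S" "u \<in> S" "(\<phi> has_derivative (\<lambda>d. d \<bullet> s)) (at x)"
  shows "\<phi> x + s \<bullet> (u - x) \<le> \<phi> u"
proof -
  \<comment> \<open>Convexity bounds \<phi> from above along the segment, whereas the directional
    lemma wants a lower bound, so it is applied to the negated function.\<close>
  have "- (\<phi> u - \<phi> x) \<le> (- s) \<bullet> (u - x)"
  proof (rule has_derivative_ge_directional[where S = "\<lambda>w. - \<phi> w"])
    show "((\<lambda>w. - \<phi> w) has_derivative (\<lambda>d. d \<bullet> - s)) (at x)"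
      using has_derivative_minus[OF assms(4)] by simp
    fix t :: real assume "0 < t" "t < 1"
    then have "\<phi> ((1 - t) *\<^sub>R x + t *\<^sub>R u) \<le> (1 - t) * \<phi> x + t * \<phi> u"
      using assms by (intro convex_onD) auto
    moreover have "(1 - t) *\<^sub>R x + t *\<^sub>R u = x + t *\<^sub>R (u - x)"
      by (simp add: algebra_simps)
    ultimately show "- \<phi> x + t * - (\<phi> u - \<phi> x) \<le> - \<phi> (x + t *\<^sub>R (u - x))"
      by (simp add: algebra_simps)
  qed
  then show ?thesis by simp
qed

lemma closed_convex_fun_line:
  assumes h: "closed_convex_fun h" and "h x = ereal a" "h u = ereal c" "0 \<le> t" "t \<le> 1"
  shows "h (x + t *\<^sub>R (u - x)) \<le> ereal ((1 - t) * a + t * c)"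
proof -
  have "(1 - t) *\<^sub>R (x, a) + t *\<^sub>R (u, c) \<in> eepigraph h"
    using assms by (intro convexD) (auto simp: closed_convex_fun_def eepigraph_def)
  moreover have "(1 - t) *\<^sub>R x + t *\<^sub>R u = x + t *\<^sub>R (u - x)"
    by (simp add: algebra_simps)
  ultimately show ?thesis
    by (simp add: eepigraph_def)
qed

lemma convex_edom:
  assumes h: "closed_convex_fun h"
  shows "convex (edom h)"
proof (rule convexI)
  fix x y and u v :: real
  assume "x \<in> edom h" "y \<in> edom h" and uv: "0 \<le> u" "0 \<le> v" "u + v = 1"
  then obtain a c where "h x = ereal a" "h y = ereal c"
    using h by (cases "h x"; cases "h y") (auto simp: edom_def closed_convex_fun_def)
  then have "h (x + v *\<^sub>R (y - x)) < \<infinity>"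
    using closed_convex_fun_line[OF h, of x a y c v] uv by (auto simp: less_le_trans)
  moreover have "u *\<^sub>R x + v *\<^sub>R y = x + v *\<^sub>R (y - x)"
    using uv by (simp add: algebra_simps flip: scaleR_add_left)
  ultimately show "u *\<^sub>R x + v *\<^sub>R y \<in> edom h"
    by (simp add: edom_def)
qed

text \<open>Sum rule in which \<open>S\<close> may be nonconvex. On the segment towards
  \<open>u\<close> the function \<open>h\<close> lies below its chord, so the subgradient inequality
  for the sum becomes linear growth of \<open>S\<close> from below, and letting the step tend to 0
  compares slopes.\<close>

lemma subdiff_add_smooth:
  fixes h :: "'a::euclidean_space \<Rightarrow> ereal"
  assumes h: "closed_convex_fun h"
    and S: "(S has_derivative (\<lambda>d. d \<bullet> s)) (at x)"
    and v: "v \<in> subdiff (\<lambda>u. h u + ereal (S u)) x"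
  shows "v - s \<in> subdiff h x"
proof -
  have fin: "\<bar>h x\<bar> \<noteq> \<infinity>" and le: "\<And>u. h x + ereal (S x) + ereal (v \<bullet> (u - x)) \<le> h u + ereal (S u)"
    using v by (auto simp: subdiff_def)
  then obtain a where a: "h x = ereal a" by auto
  have "h x + ereal ((v - s) \<bullet> (u - x)) \<le> h u" for u
  proof (cases "h u")
    case (real c)
    have "v \<bullet> (u - x) - (c - a) \<le> s \<bullet> (u - x)"
    proof (rule has_derivative_ge_directional[OF S])
      fix t :: real assume t: "0 < t" "t < 1"
      have "ereal (a + S x + v \<bullet> (t *\<^sub>R (u - x))) \<le> h (x + t *\<^sub>R (u - x)) + ereal (S (x + t *\<^sub>R (u - x)))"
        using le[of "x + t *\<^sub>R (u - x)"] a by simp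
      also have "\<dots> \<le> ereal ((1 - t) * a + t * c) + ereal (S (x + t *\<^sub>R (u - x)))"
        using closed_convex_fun_line[OF h a real, of t] t by (intro add_right_mono) auto
      finally show "S x + t * (v \<bullet> (u - x) - (c - a)) \<le> S (x + t *\<^sub>R (u - x))"
        by (simp add: algebra_simps)
    qed
    then show ?thesis using a real by (simp add: algebra_simps)
  qed (use h in \<open>auto simp: closed_convex_fun_def\<close>)
  with fin show ?thesis by (simp add: subdiff_def)
qed

lemma closed_subdiff: "closed (subdiff \<phi> x)"
proof -
  have "closed {v. \<phi> x + ereal (v \<bullet> (u - x)) \<le> \<phi> u}" if "\<bar>\<phi> x\<bar> \<noteq> \<infinity>" for u
  proof (cases "\<phi> u")
    case (real c)
    obtain a where "\<phi> x = ereal a" using \<open>\<bar>\<phi> x\<bar> \<noteq> \<infinity>\<close> by auto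
    then have "{v. \<phi> x + ereal (v \<bullet> (u - x)) \<le> \<phi> u} = {v. a + v \<bullet> (u - x) \<le> c}"
      using real by simp
    then show ?thesis by (simp add: closed_Collect_le continuous_intros)
  qed (use that in auto)
  moreover have "subdiff \<phi> x =
      (if \<bar>\<phi> x\<bar> \<noteq> \<infinity> then \<Inter>u. {v. \<phi> x + ereal (v \<bullet> (u - x)) \<le> \<phi> u} else {})"
    unfolding subdiff_def by (rule set_eqI) simp
  moreover have "closed (\<Inter>u. {v. \<phi> x + ereal (v \<bullet> (u - x)) \<le> \<phi> u})" if "\<bar>\<phi> x\<bar> \<noteq> \<infinity>"
    using calculation(1)[OF that] by (intro closed_INT ballI)
  ultimately show ?thesis
    by simp
qed

lemma closed_wc_subdiff: "closed (wc_subdiff \<rho> \<psi> x)"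
  unfolding wc_subdiff_def using closed_translation_subtract[OF closed_subdiff] by blast

text \<open>Turns the tolerance on a distance into an actual residual vector. A finite bound
  excludes the empty set, and closedness supplies a nearest point.\<close>

lemma dist_set_attained:
  fixes S :: "'a::euclidean_space set"
  assumes "closed S" "dist_set a S \<le> ereal r"
  obtains s where "s \<in> S" "dist a s \<le> r"
proof -
  have "S \<noteq> {}"
    using assms(2) by (auto simp: dist_set_def top_ereal_def)
  then obtain s where s: "s \<in> S" "\<forall>u\<in>S. dist a s \<le> dist a u"
    by (rule distance_attains_inf[OF assms(1), of a]) auto
  then have "ereal (dist a s) \<le> dist_set a S"
    unfolding dist_set_def by (intro INF_greatest) auto
  then have "ereal (dist a s) \<le> ereal r"
    using assms(2) by (rule order_trans)
  then show thesis using s that by simp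
qed

text \<open>The Riesz representer of the derivative, assembled from its values on the basis, is
  unique; hence the definite description in \<open>grad\<close> denotes it.\<close>

lemma has_derivative_grad:
  fixes \<phi> :: "'a::euclidean_space \<Rightarrow> real"
  assumes "\<phi> differentiable (at x)"
  shows "(\<phi> has_derivative (\<lambda>d. d \<bullet> grad \<phi> x)) (at x)"
proof -
  obtain T where T: "(\<phi> has_derivative T) (at x)"
    using assms by (auto simp: differentiable_def)
  then have lin: "linear T" by (rule has_derivative_linear)
  define s where "s = (\<Sum>i\<in>Basis. T i *\<^sub>R i)"
  have "T d = d \<bullet> s" for d
  proof -
    have "T d = T (\<Sum>i\<in>Basis. (d \<bullet> i) *\<^sub>R i)" by (simp add: euclidean_representation)
    then show ?thesis
      by (simp add: linear_sum[OF lin] linear_scale[OF lin] s_def inner_sum_right mult.commute)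
  qed
  then have s: "GDERIV \<phi> x :> s"
    using T unfolding gderiv_def by (metis (no_types, lifting) ext)
  moreover have "t = s" if "GDERIV \<phi> x :> t" for t
  proof -
    have "(\<lambda>d. d \<bullet> t) = (\<lambda>d. d \<bullet> s)"
      using that s unfolding gderiv_def by (rule has_derivative_unique)
    then have "(t - s) \<bullet> t = (t - s) \<bullet> s" by meson
    then have "(t - s) \<bullet> (t - s) = 0" unfolding inner_diff_right by linarith
    then show ?thesis by simp
  qed
  ultimately have "grad \<phi> x = s"
    unfolding grad_def by blast
  then show ?thesis using s by (simp add: gderiv_def)
qed

section \<open>The squared positive part\<close>

lemma pos_part_sq_tangent:
  fixes s t :: real
  shows "\<bar>(max s 0)\<^sup>2 - (max t 0)\<^sup>2 - 2 * max t 0 * (s - t)\<bar> \<le> (s - t)\<^sup>2"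
    and "(max t 0)\<^sup>2 + 2 * max t 0 * (s - t) \<le> (max s 0)\<^sup>2"
proof -
  have sq: "(s - t)\<^sup>2 = s\<^sup>2 - 2 * (s * t) + t\<^sup>2" "2 * t * (s - t) = 2 * (s * t) - 2 * t\<^sup>2"
    by (simp_all add: power2_eq_square algebra_simps)
  have nonneg: "0 \<le> (s - t)\<^sup>2" "0 \<le> s\<^sup>2" "0 \<le> t\<^sup>2" by auto
  \<comment> \<open>For opposite signs, \<open>s * t \<le> 0\<close> is the only nonlinear
    information required; with it every case is linear in the squares and the product.\<close>
  consider "max s 0 = s" "max t 0 = t" | "max s 0 = s" "max t 0 = 0" "s * t \<le> 0"
    | "max s 0 = 0" "max t 0 = t" "s * t \<le> 0" | "max s 0 = 0" "max t 0 = 0"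
    by (cases "s \<le> 0"; cases "t \<le> 0") (auto simp: mult_nonneg_nonpos mult_nonpos_nonneg max_def)
  then have "\<bar>(max s 0)\<^sup>2 - (max t 0)\<^sup>2 - 2 * max t 0 * (s - t)\<bar> \<le> (s - t)\<^sup>2 \<and>
      (max t 0)\<^sup>2 + 2 * max t 0 * (s - t) \<le> (max s 0)\<^sup>2"
  proof cases
    case 1 then show ?thesis unfolding 1 sq power_zero_numeral using nonneg sq(1) by (intro conjI; linarith)
  next
    case 2 then show ?thesis unfolding 2 sq power_zero_numeral using nonneg sq(1) by (intro conjI; linarith)
  next
    case 3 then show ?thesis unfolding 3 sq power_zero_numeral using nonneg sq(1) by (intro conjI; linarith)
  next
    case 4 then show ?thesis unfolding 4 sq power_zero_numeral using nonneg sq(1) by (intro conjI; linarith)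
  qed
  then show "\<bar>(max s 0)\<^sup>2 - (max t 0)\<^sup>2 - 2 * max t 0 * (s - t)\<bar> \<le> (s - t)\<^sup>2"
    and "(max t 0)\<^sup>2 + 2 * max t 0 * (s - t) \<le> (max s 0)\<^sup>2"
    by auto
qed

text \<open>The kink disappears after squaring: the quadratic remainder makes the difference
  quotient err by at most \<open>\<bar>s - t\<bar>\<close>, also at 0.\<close>

lemma has_real_derivative_pos_part_sq:
  "((\<lambda>t::real. (max t 0)\<^sup>2) has_real_derivative 2 * max t 0) (at t)"
proof -
  have "((\<lambda>s. ((max s 0)\<^sup>2 - (max t 0)\<^sup>2) / (s - t) - 2 * max t 0) \<longlongrightarrow> 0) (at t)"
  proof (rule Lim_null_comparison)
    show "\<forall>\<^sub>F s in at t. norm (((max s 0)\<^sup>2 - (max t 0)\<^sup>2) / (s - t) - 2 * max t 0) \<le> \<bar>s - t\<bar>"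
      unfolding eventually_at_filter
    proof (intro always_eventually allI impI)
      fix s assume "s \<noteq> t"
      then have "((max s 0)\<^sup>2 - (max t 0)\<^sup>2) / (s - t) - 2 * max t 0
          = ((max s 0)\<^sup>2 - (max t 0)\<^sup>2 - 2 * max t 0 * (s - t)) / (s - t)"
        by (simp add: field_simps)
      moreover have "\<bar>(max s 0)\<^sup>2 - (max t 0)\<^sup>2 - 2 * max t 0 * (s - t)\<bar> / \<bar>s - t\<bar> \<le> (s - t)\<^sup>2 / \<bar>s - t\<bar>"
        by (intro divide_right_mono pos_part_sq_tangent(1)) auto
      moreover have "(s - t)\<^sup>2 / \<bar>s - t\<bar> = \<bar>s - t\<bar>"
        using \<open>s \<noteq> t\<close> by (simp add: power2_eq_square field_simps flip: abs_mult)
      ultimately show "norm (((max s 0)\<^sup>2 - (max t 0)\<^sup>2) / (s - t) - 2 * max t 0) \<le> \<bar>s - t\<bar>"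
        by (simp add: abs_divide)
    qed
    show "((\<lambda>s. \<bar>s - t\<bar>) \<longlongrightarrow> 0) (at t)"
      by (rule tendsto_eq_intros refl | simp)+
  qed
  then show ?thesis
    by (simp add: has_field_derivative_iff LIM_zero_iff)
qed

text \<open>A segment from \<open>a\<close> to a point outside \<open>X\<close> crosses the
  frontier. As \<open>X\<close> is closed, the crossing point is not the endpoint, so it is strictly
  nearer to \<open>a\<close>; this is why the closed ball works.\<close>

lemma cball_infdist_frontier_subset:
  fixes X :: "'a::euclidean_space set"
  assumes "compact X" "a \<in> interior X"
  shows "cball a (infdist a (frontier X)) \<subseteq> X" and "infdist a (frontier X) > 0"
proof -
  have aX: "a \<in> X" using assms interior_subset by blast
  have "X \<noteq> UNIV" using assms(1) not_compact_UNIV by auto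
  then have ne: "frontier X \<noteq> {}" using aX frontier_not_empty by blast
  have "a \<notin> frontier X" using assms(2) by (simp add: frontier_def)
  then show "infdist a (frontier X) > 0"
    using in_closed_iff_infdist_zero[OF frontier_closed ne, of a] infdist_nonneg[of a "frontier X"]
    by simp
  show "cball a (infdist a (frontier X)) \<subseteq> X"
  proof
    fix u assume u: "u \<in> cball a (infdist a (frontier X))"
    show "u \<in> X"
    proof (rule ccontr)
      assume "u \<notin> X"
      then have "closed_segment a u \<inter> frontier X \<noteq> {}"
        using aX by (intro connected_Int_frontier) auto
      then obtain q where q: "q \<in> closed_segment a u" "q \<in> frontier X" by blast
      have "q \<in> X" using q(2) assms(1) by (simp add: frontier_def compact_imp_closed)
      then have "q \<noteq> u" using \<open>u \<notin> X\<close> by auto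
      then have "dist a q < dist a u"
        using q(1) by (smt (verit) between between_mem_segment zero_less_dist_iff)
      moreover have "infdist a (frontier X) \<le> dist a q"
        using q(2) by (rule infdist_le)
      ultimately show False using u by simp
    qed
  qed
qed

section \<open>Smallest positive eigenvalue of the Gram matrix\<close>

lemma inner_matrix_transpose:
  fixes M :: "real^'d^'n"
  shows "(transpose M *v u) \<bullet> d = u \<bullet> (M *v d)"
  by (metis dot_lmul_matrix transpose_matrix_vector)

text \<open>Gives meaning to \<open>Min\<close> in \<open>lambda_min_pos\<close>. Eigenvectors of a
  symmetric matrix for distinct eigenvalues are orthogonal, hence independent, hence finitely
  many.\<close>

lemma finite_pos_eigenvalues:
  fixes M :: "real^'n^'n"
  assumes "transpose M = M"
  shows "finite (pos_eigenvalues M)"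
proof -
  define w where "w l = (SOME v. v \<noteq> 0 \<and> M *v v = l *\<^sub>R v)" for l
  have w: "w l \<noteq> 0" "M *v w l = l *\<^sub>R w l" if "l \<in> pos_eigenvalues M" for l
    using that someI_ex[of "\<lambda>v. v \<noteq> 0 \<and> M *v v = l *\<^sub>R v"]
    by (auto simp: pos_eigenvalues_def w_def)
  have orth: "w k \<bullet> w l = 0" if "k \<in> pos_eigenvalues M" "l \<in> pos_eigenvalues M" "k \<noteq> l" for k l
  proof -
    have "k * (w k \<bullet> w l) = l * (w k \<bullet> w l)"
      using inner_matrix_transpose[of M "w k" "w l"] assms w that by simp
    then show ?thesis using that by simp
  qed
  have "pairwise orthogonal (w ` pos_eigenvalues M)"
    by (auto simp: pairwise_def orthogonal_def intro: orth)
  moreover have "0 \<notin> w ` pos_eigenvalues M" using w by auto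
  ultimately have "finite (w ` pos_eigenvalues M)"
    using pairwise_orthogonal_independent independent_imp_finite by blast
  moreover have "inj_on w (pos_eigenvalues M)"
    using orth w by (metis inj_onI inner_eq_zero_iff)
  ultimately show ?thesis by (rule finite_imageD)
qed

text \<open>The minimiser of \<open>\<parallel>A\<^sup>T y\<parallel>\<close> over the unit sphere of the range of \<open>A\<close> is an eigenvector.\<close>

lemma lambda_min_pos_gram:
  fixes A :: "real^'d^'n"
  assumes "A \<noteq> 0"
  shows "lambda_min_pos (A ** transpose A) > 0"
    and "y \<in> range ((*v) A) \<Longrightarrow>
      sqrt (lambda_min_pos (A ** transpose A)) * norm y \<le> norm (transpose A *v y)"
proof -
  let ?M = "A ** transpose A" and ?T = "transpose A"
  have sym: "transpose ?M = ?M" by (simp add: matrix_transpose_mul)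
  define V where "V = range ((*v) A)"
  have sub: "subspace V"
    unfolding V_def by (intro linear_subspace_image) auto
  define C where "C = V \<inter> sphere 0 1"
  have scale: "(1 / norm u) *\<^sub>R u \<in> C" if "u \<in> V" "u \<noteq> 0" for u
    using that sub by (simp add: C_def subspace_scale)
  obtain d where "A *v d \<noteq> 0"
    using assms by (metis matrix_eq matrix_vector_mult_0)
  then have "C \<noteq> {}" using scale[of "A *v d"] by (auto simp: V_def)
  moreover have "compact C"
    unfolding C_def using sub by (intro closed_Int_compact closed_subspace) auto
  ultimately obtain y0 where y0: "y0 \<in> C" "\<forall>u\<in>C. norm (?T *v y0) \<le> norm (?T *v u)"
    using continuous_attains_inf[of C "\<lambda>u. norm (?T *v u)"]
    by (metis continuous_on_norm linear_continuous_on matrix_vector_mul_bounded_linear)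
  define \<mu> where "\<mu> = (norm (?T *v y0))\<^sup>2"
  have y0V: "y0 \<in> V" and n1: "norm y0 = 1" using y0 by (auto simp: C_def)
  have low: "\<mu> * (norm u)\<^sup>2 \<le> (norm (?T *v u))\<^sup>2" if "u \<in> V" for u
  proof (cases "u = 0")
    case False
    have "norm (?T *v y0) \<le> norm (?T *v ((1 / norm u) *\<^sub>R u))"
      using y0 scale[OF that False] by blast
    also have "\<dots> = norm (?T *v u) / norm u"
      by (simp add: matrix_vector_mult_scaleR)
    finally have "norm (?T *v y0) * norm u \<le> norm (?T *v u)"
      using False by (simp add: field_simps)
    then have "(norm (?T *v y0) * norm u)\<^sup>2 \<le> (norm (?T *v u))\<^sup>2"
      by (intro power_mono) auto
    then show ?thesis by (simp add: \<mu>_def power_mult_distrib)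
  qed simp
  have "\<mu> > 0"
  proof -
    obtain e where e: "y0 = A *v e" using y0V by (auto simp: V_def)
    have "?T *v y0 \<noteq> 0"
    proof
      assume "?T *v y0 = 0"
      then have "y0 \<bullet> y0 = 0"
        using inner_matrix_transpose[of A y0 e] e by simp
      then show False using n1 by simp
    qed
    then show ?thesis by (simp add: \<mu>_def)
  qed
  \<comment> \<open>The eigenvalue residual \<open>e\<close> stays in the range of \<open>A\<close>,
    so it is an admissible variation of the minimiser. Minimality makes a quadratic in
    \<open>t\<close> with linear coefficient \<open>2 * (e \<bullet> e)\<close> nonnegative, which
    forces \<open>e = 0\<close>.\<close>
  have eig: "?M *v y0 = \<mu> *\<^sub>R y0"
  proof -
    define e where "e = ?M *v y0 - \<mu> *\<^sub>R y0"
    have "?M *v y0 \<in> V"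
      by (auto simp: V_def matrix_vector_mul_assoc[symmetric])
    then have eV: "e \<in> V"
      unfolding e_def using sub y0V by (intro subspace_diff subspace_scale)
    have ee: "(?T *v y0) \<bullet> (?T *v e) - \<mu> * (y0 \<bullet> e) = e \<bullet> e"
    proof -
      have "(?T *v y0) \<bullet> (?T *v e) = (?M *v y0) \<bullet> e"
        by (metis inner_commute inner_matrix_transpose matrix_vector_mul_assoc)
      then show ?thesis by (simp add: e_def inner_diff_left)
    qed
    define q where "q = (norm (?T *v e))\<^sup>2 - \<mu> * (norm e)\<^sup>2"
    have quad: "0 \<le> 2 * t * (e \<bullet> e) + t\<^sup>2 * q" for t
    proof -
      have "y0 + t *\<^sub>R e \<in> V" using sub y0V eV by (intro subspace_add subspace_scale)
      from low[OF this] have "0 \<le> (?T *v (y0 + t *\<^sub>R e)) \<bullet> (?T *v (y0 + t *\<^sub>R e))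
          - \<mu> * ((y0 + t *\<^sub>R e) \<bullet> (y0 + t *\<^sub>R e))"
        by (simp add: power2_norm_eq_inner)
      also have "\<dots> = (?T *v y0) \<bullet> (?T *v y0) - \<mu> * (y0 \<bullet> y0)
          + 2 * t * ((?T *v y0) \<bullet> (?T *v e) - \<mu> * (y0 \<bullet> e))
          + t\<^sup>2 * ((?T *v e) \<bullet> (?T *v e) - \<mu> * (e \<bullet> e))"
        by (simp add: matrix_vector_right_distrib matrix_vector_mult_scaleR
            inner_add_left inner_add_right inner_commute power2_eq_square algebra_simps)
      also have "(?T *v y0) \<bullet> (?T *v y0) - \<mu> * (y0 \<bullet> y0) = 0"
        using n1 by (simp add: \<mu>_def flip: power2_norm_eq_inner)
      finally show ?thesis unfolding ee q_def power2_norm_eq_inner by linarith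
    qed
    have "e \<bullet> e = 0"
    proof (rule ccontr)
      assume "e \<bullet> e \<noteq> 0"
      then have pos: "e \<bullet> e > 0" using inner_ge_zero[of e] by linarith
      \<comment> \<open>Negative, and so short that \<open>t * q\<close> is at least
        \<open>- (e \<bullet> e)\<close>: the linear term wins.\<close>
      define t where "t = - (e \<bullet> e) / (\<bar>q\<bar> + 1)"
      have "t < 0" using pos by (simp add: t_def divide_neg_pos)
      have "t * (\<bar>q\<bar> + 1) = - (e \<bullet> e)" by (simp add: t_def)
      moreover have "t * q \<ge> t * (\<bar>q\<bar> + 1)"
        using \<open>t < 0\<close> by (intro mult_left_mono_neg) auto
      ultimately have "2 * (e \<bullet> e) + t * q > 0" using pos by linarith
      then have "t * (2 * (e \<bullet> e) + t * q) < 0"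
        using \<open>t < 0\<close> by (simp add: mult_neg_pos)
      then show False using quad[of t] by (simp add: algebra_simps power2_eq_square)
    qed
    then show ?thesis by (simp add: e_def)
  qed
  have "\<mu> \<in> pos_eigenvalues ?M"
    using eig \<open>\<mu> > 0\<close> n1 by (auto simp: pos_eigenvalues_def intro!: exI[of _ y0])
  moreover have fin: "finite (pos_eigenvalues ?M)"
    by (rule finite_pos_eigenvalues[OF sym])
  \<comment> \<open>\<mu> is itself a positive eigenvalue, so the smallest one lies below it; this
    direction suffices for the norm bound.\<close>
  ultimately have le: "lambda_min_pos ?M \<le> \<mu>" and "lambda_min_pos ?M \<in> pos_eigenvalues ?M"
    unfolding lambda_min_pos_def by (auto intro!: Min_in)
  then show "lambda_min_pos ?M > 0" by (simp add: pos_eigenvalues_def)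
  assume "y \<in> range ((*v) A)"
  then have "\<mu> * (norm y)\<^sup>2 \<le> (norm (?T *v y))\<^sup>2" using low by (simp add: V_def)
  then have "lambda_min_pos ?M * (norm y)\<^sup>2 \<le> (norm (?T *v y))\<^sup>2"
    using mult_right_mono[OF le, of "(norm y)\<^sup>2"] by simp
  then have "sqrt (lambda_min_pos ?M * (norm y)\<^sup>2) \<le> sqrt ((norm (?T *v y))\<^sup>2)"
    by (rule real_sqrt_le_mono)
  then show "sqrt (lambda_min_pos ?M) * norm y \<le> norm (?T *v y)"
    by (simp add: real_sqrt_mult)
qed

lemma norm_sq_diff_expand:
  "\<rho> / 2 * (norm (w - u))\<^sup>2 = \<rho> / 2 * (norm w)\<^sup>2 - \<rho> / 2 * (norm u)\<^sup>2 - \<rho> * (u \<bullet> (w - u))"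
  for u w :: "'a::real_inner"
  by (simp add: power2_norm_eq_inner inner_diff_left inner_diff_right inner_commute algebra_simps)

lemma norm_sq_vec: "(norm a)\<^sup>2 = (\<Sum>i\<in>UNIV. (a $ i)\<^sup>2)" for a :: "real^'m"
  by (simp add: norm_vec_def L2_set_def sum_nonneg)

lemma norm_sq_Pair: "(norm (a, b))\<^sup>2 = (norm a)\<^sup>2 + (norm b)\<^sup>2"
  by (simp add: norm_Pair)

lemma jacobian_component_grad:
  fixes g :: "real^'d \<Rightarrow> real^'m"
  assumes "\<And>i. (\<lambda>u. g u $ i) differentiable (at x)"
  shows "(jacobian g (at x) *v d) $ i = d \<bullet> grad (\<lambda>u. g u $ i) x"
proof -
  have "g differentiable (at x)"
    unfolding differentiable_componentwise_within[of g]
    using assms by (auto simp: Basis_vec_def inner_axis)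
  then have "(g has_derivative (\<lambda>d. jacobian g (at x) *v d)) (at x)"
    by (simp add: jacobian_works)
  then have "((\<lambda>u. g u $ i) has_derivative (\<lambda>d. (jacobian g (at x) *v d) $ i)) (at x)"
    by (rule bounded_linear.has_derivative[OF bounded_linear_vec_nth])
  from has_derivative_unique[OF this has_derivative_grad[OF assms]]
  show ?thesis by meson
qed

lemma norm_le_sum_nonneg_cart:
  fixes a :: "real^'m"
  assumes "\<And>i. 0 \<le> a $ i"
  shows "norm a \<le> (\<Sum>i\<in>UNIV. a $ i)"
  using norm_le_l1_cart[of a] assms by simp

section \<open>The series of \<open>1 / (n ln\<^sup>2 n)\<close>\<close>

lemma inverse_n_ln_sq_le_telescope:
  assumes "2 \<le> (k::nat)"
  shows "1 / ((real k + 1) * (ln (real k + 1))\<^sup>2) \<le> 1 / ln (real k) - 1 / ln (real k + 1)"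
proof -
  let ?a = "ln (real k)" and ?c = "ln (real k + 1)"
  have a: "0 < ?a" "?a \<le> ?c" "0 < ?c" using assms by auto
  \<comment> \<open>The increment of the logarithm is at least \<open>1 / (k + 1)\<close>. Dividing
    it by \<open>ln k * ln (k + 1)\<close>, which is at most \<open>(ln (k + 1))\<^sup>2\<close>,
    gives the difference of reciprocals.\<close>
  have "ln (real k) - ln (real k + 1) \<le> (real k - (real k + 1)) / (real k + 1)"
    using assms by (intro ln_diff_le) auto
  then have "1 / (real k + 1) \<le> ?c - ?a" by simp
  then have "1 / (real k + 1) / (?c * ?c) \<le> (?c - ?a) / (?a * ?c)"
    using a by (intro frac_le mult_right_mono mult_pos_pos) auto
  also have "\<dots> = 1 / ?a - 1 / ?c" using a by (simp add: field_simps)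
  finally show ?thesis by (simp add: power2_eq_square)
qed

text \<open>A potential whose decrements dominate the summable sequence \<open>1 / (n ln\<^sup>2 n)\<close>;
  its value at \<open>1\<close> absorbs the term \<open>n = 2\<close>, for which \<open>ln (n - 1) = 0\<close>.\<close>

definition ln_potential :: "nat \<Rightarrow> real" where
  "ln_potential k = (if k = 1 then 1 / ln 2 + 1 / (2 * (ln 2)\<^sup>2) else 1 / ln (real k))"

lemma ln_potential_telescope:
  assumes "1 \<le> k"
  shows "1 / ((real k + 1) * (ln (real k + 1))\<^sup>2) \<le> ln_potential k - ln_potential (Suc k)"
proof (cases "k = 1")
  case False
  then show ?thesis
    using assms inverse_n_ln_sq_le_telescope[of k] by (simp add: ln_potential_def add.commute)
qed (simp add: ln_potential_def)

text \<open>From \<open>ln 2 \<ge> 2 / 3\<close>, the value at 1 is at most 3/2 + 9/8 < 3, and later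
  values are at most 3/2.\<close>

lemma ln_potential_bounds:
  assumes "1 \<le> k"
  shows "0 \<le> ln_potential k" "ln_potential k \<le> 3"
proof -
  have l2: "2 / 3 \<le> ln (2::real)" by (rule ln2_ge_two_thirds)
  have inv: "1 / ln (2::real) \<le> 3 / 2"
    using l2 by (simp add: field_simps)
  have "(2 / 3)\<^sup>2 \<le> (ln (2::real))\<^sup>2" using l2 by (intro power_mono) auto
  then have inv2: "1 / (2 * (ln (2::real))\<^sup>2) \<le> 9 / 8"
    using l2 by (simp add: field_simps power2_eq_square)
  show "0 \<le> ln_potential k" using assms by (simp add: ln_potential_def)
  show "ln_potential k \<le> 3"
  proof (cases "k = 1")
    case True
    then show ?thesis using inv inv2 by (simp add: ln_potential_def)
  next
    case False
    then have "ln 2 \<le> ln (real k)" using assms by simp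
    then have "1 / ln (real k) \<le> 1 / ln 2" using l2 by (intro divide_left_mono) auto
    then show ?thesis using inv False by (simp add: ln_potential_def)
  qed
qed

lemma abs_real_of_ereal_le_SUP:
  fixes F :: "'a::euclidean_space \<Rightarrow> ereal"
  assumes "compact X" "continuous_on X F" "\<And>u. u \<in> X \<Longrightarrow> \<bar>F u\<bar> \<noteq> \<infinity>" "u \<in> X"
  shows "\<bar>real_of_ereal (F u)\<bar> \<le> (SUP u\<in>X. \<bar>real_of_ereal (F u)\<bar>)"
proof (rule cSUP_upper[OF assms(4)])
  have "continuous_on X (real_of_ereal \<circ> F)"
    using assms(2,3) by (simp add: continuous_on_iff_real)
  then have "compact ((\<lambda>u. \<bar>real_of_ereal (F u)\<bar>) ` X)"
    using assms(1) by (intro compact_continuous_image continuous_on_rabs) (auto simp: o_def)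
  then show "bdd_above ((\<lambda>u. \<bar>real_of_ereal (F u)\<bar>) ` X)"
    by (intro bounded_imp_bdd_above compact_imp_bounded)
qed

text \<open>Here \<open>e\<close> is the tolerance of the inexact minimisation and \<open>t\<close> the length of the primal step.\<close>

lemma long_step_descent:
  fixes \<rho> \<epsilon> e t :: real
  assumes "0 < \<rho>" "0 < \<epsilon>" "e \<le> \<epsilon> / 8" "\<epsilon> < e + 2 * \<rho> * t"
  shows "11 / 50 * (\<epsilon>\<^sup>2 / \<rho>) \<le> 3 / 2 * \<rho> * t\<^sup>2 - e * t"
proof -
  \<comment> \<open>With the tolerance at most \<epsilon>/8, half of the remaining 7/8 gives 7/16.
    The second factor is then 3/2 * 7/16 - 1/8 = 17/32, and 7/16 * 17/32 exceeds 11/50, a constant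
    chosen just above 1/5.\<close>
  have t: "7 / 16 * \<epsilon> \<le> \<rho> * t" using assms(3,4) by linarith
  then have "0 < \<rho> * t" using assms(2) by linarith
  then have t0: "0 < t" using assms(1) by (simp add: zero_less_mult_iff)
  have "11 / 50 * \<epsilon>\<^sup>2 \<le> 7 / 16 * \<epsilon> * (17 / 32 * \<epsilon>)"
    by (simp add: power2_eq_square)
  also have "\<dots> \<le> (\<rho> * t) * (3 / 2 * (\<rho> * t) - \<epsilon> / 8)"
    by (rule mult_mono) (use t \<open>0 < \<rho> * t\<close> assms(2) in linarith)+
  also have "\<dots> = \<rho> * (3 / 2 * \<rho> * t\<^sup>2 - \<epsilon> / 8 * t)"
    by (simp add: power2_eq_square algebra_simps)
  finally have "11 / 50 * (\<epsilon>\<^sup>2 / \<rho>) \<le> 3 / 2 * \<rho> * t\<^sup>2 - \<epsilon> / 8 * t"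
    using assms(1) by (simp add: field_simps)
  moreover have "e * t \<le> \<epsilon> / 8 * t" using assms(3) t0 by (intro mult_right_mono) auto
  ultimately show ?thesis by linarith
qed

subsection \<open>Bounded multipliers\<close>

text \<open>No schedule is fixed yet: \<beta> is any positive and \<open>v\<close> any nonnegative
  sequence. Slater's condition is carried as a ball of radius \<tau> inside \<open>X\<close> on
  which each constraint keeps half of its margin.\<close>

locale dpalm_run =
  fixes f :: "real^'d \<Rightarrow> real" and h F :: "real^'d \<Rightarrow> ereal" and X :: "(real^'d) set"
    and A :: "real^'d^'n" and b :: "real^'n" and g :: "real^'d \<Rightarrow> real^'m"
    and xfeas :: "real^'d" and \<beta> v \<epsilon>s :: "nat \<Rightarrow> real"
    and x :: "nat \<Rightarrow> real^'d" and y :: "nat \<Rightarrow> real^'n" and z :: "nat \<Rightarrow> real^'m"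
    and \<rho> r\<^sub>h B\<^sub>g B\<^sub>f gmin \<tau> :: real
  assumes F: "F = (\<lambda>u. ereal (f u) + h u)"
    and X: "X = edom F" "compact X"
    and f_wc: "\<rho> > 0" "weakly_convex_on \<rho> X f"
    and h: "closed_convex_fun h"
    and g_convex: "\<And>i. convex_on X (\<lambda>u. g u $ i)"
    and g_diff: "\<And>u i. u \<in> X \<Longrightarrow> (\<lambda>u. g u $ i) differentiable (at u)"
    and f_diff: "\<And>u. u \<in> X \<Longrightarrow> f differentiable (at u)"
    and slater: "cball xfeas \<tau> \<subseteq> X" "\<tau> > 0" "A *v xfeas = b" "gmin > 0"
      "\<And>i. g xfeas $ i \<le> - gmin" "B\<^sub>g * \<tau> \<le> gmin / 2"
    and r\<^sub>h: "r\<^sub>h > 0" "\<And>u. u \<in> X \<Longrightarrow> subdiff h u \<subseteq> normal_cone X u + cball 0 r\<^sub>h"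
    and B\<^sub>g: "B\<^sub>g > 0"
      "\<And>u w i. u \<in> X \<Longrightarrow> w \<in> X \<Longrightarrow> \<bar>g u $ i - g w $ i\<bar> \<le> B\<^sub>g * norm (u - w)"
    and B\<^sub>f: "B\<^sub>f > 0" "\<And>u. u \<in> X \<Longrightarrow> norm (grad f u) \<le> B\<^sub>f"
    and \<beta>: "\<And>k. \<beta> k > 0"
    and v: "\<And>k. v k \<ge> 0"
    and \<epsilon>s: "\<And>k. \<epsilon>s k \<le> 1"
    and iterates: "dpalm F A b g \<rho> \<beta> v \<epsilon>s x y z"
begin

definition Y where "Y k = y k + \<beta> k *\<^sub>R (A *v x (Suc k) - b)"

definition Z :: "nat \<Rightarrow> real^'m" where
  "Z k = (\<chi> i. max (z k $ i + \<beta> k * g (x (Suc k)) $ i) 0)"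

definition r where "r k = infeas A b g (x (Suc k))"

definition \<alpha> where "\<alpha> k = damped_step (\<beta> k) (v k) (r k)"

abbreviation J where "J k \<equiv> jacobian g (at (x (Suc k)))"

lemma X_h: "X = edom h"
  unfolding X(1) F edom_def by auto

lemma dist_X: "u \<in> X \<Longrightarrow> w \<in> X \<Longrightarrow> norm (u - w) \<le> diameter X"
  using diameter_bounded_bound[OF compact_imp_bounded[OF X(2)]] by (simp add: dist_norm)

lemma h_finite: "u \<in> X \<Longrightarrow> h u = ereal (real_of_ereal (h u))"
  using h by (cases "h u") (auto simp: X_h edom_def closed_convex_fun_def)

lemma f_above:
  assumes "u \<in> X" "w \<in> X"
  shows "f u + grad f u \<bullet> (w - u) - \<rho> / 2 * (norm (w - u))\<^sup>2 \<le> f w"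
proof -
  have "((\<lambda>w. f w + \<rho> / 2 * (norm w)\<^sup>2) has_derivative (\<lambda>d. d \<bullet> (grad f u + \<rho> *\<^sub>R u))) (at u)"
    unfolding power2_norm_eq_inner
    by (rule derivative_eq_intros has_derivative_grad[OF f_diff[OF assms(1)]] refl)+
      (simp add: fun_eq_iff inner_commute inner_add_left inner_add_right algebra_simps)
  then have "f u + \<rho> / 2 * (norm u)\<^sup>2 + (grad f u + \<rho> *\<^sub>R u) \<bullet> (w - u) \<le> f w + \<rho> / 2 * (norm w)\<^sup>2"
    by (rule convex_on_above_gradient[OF f_wc(2)[unfolded weakly_convex_on_def] assms])
  then show ?thesis
    unfolding norm_sq_diff_expand inner_add_left inner_scaleR_left by linarith
qed

lemma g_above:
  assumes "u \<in> X" "w \<in> X"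
  shows "g u $ i + grad (\<lambda>u. g u $ i) u \<bullet> (w - u) \<le> g w $ i"
  using convex_on_above_gradient[OF g_convex assms has_derivative_grad[OF g_diff[OF assms(1)]]] .

text \<open>Supplies concrete elements of the set whose distance to 0 the KKT condition measures.
  The quadratic added in \<open>wc_subdiff\<close> cancels the weak convexity defect of
  \<open>f\<close>.\<close>

lemma wc_subdiff_F:
  assumes e: "e \<in> subdiff h u" and u: "u \<in> X"
  shows "grad f u + e \<in> wc_subdiff \<rho> F u"
proof -
  have "F u + ereal (\<rho> / 2 * (norm u)\<^sup>2) + ereal ((grad f u + e + \<rho> *\<^sub>R u) \<bullet> (w - u))
      \<le> F w + ereal (\<rho> / 2 * (norm w)\<^sup>2)" for w
  proof (cases "w \<in> X")
    case True
    then obtain a c where ac: "h u = ereal a" "h w = ereal c"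
      using h_finite u by metis
    have "h u + ereal (e \<bullet> (w - u)) \<le> h w"
      using e by (simp add: subdiff_def)
    then have "a + e \<bullet> (w - u) \<le> c" using ac by simp
    then have "f u + a + \<rho> / 2 * (norm u)\<^sup>2 + (grad f u + e + \<rho> *\<^sub>R u) \<bullet> (w - u)
        \<le> f w + c + \<rho> / 2 * (norm w)\<^sup>2"
      using f_above[OF u True]
      unfolding norm_sq_diff_expand inner_add_left inner_scaleR_left by linarith
    then show ?thesis using ac by (simp add: F)
  next
    case False
    then have "F w = \<infinity>" by (auto simp: X(1) edom_def)
    then show ?thesis by simp
  qed
  moreover have "\<bar>F u + ereal (\<rho> / 2 * (norm u)\<^sup>2)\<bar> \<noteq> \<infinity>"
    unfolding F by (subst h_finite[OF u]) simp
  ultimately have "grad f u + e + \<rho> *\<^sub>R u \<in> subdiff (\<lambda>u. F u + ereal (\<rho> / 2 * (norm u)\<^sup>2)) u"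
    by (simp add: subdiff_def)
  then show ?thesis
    unfolding wc_subdiff_def by (rule image_eqI[rotated]) simp
qed

section \<open>Approximate stationarity of the primal step\<close>

lemma wc_subdiff_prox_obtain:
  obtains w where "norm w \<le> \<epsilon>s k"
    "w \<in> wc_subdiff \<rho> (\<lambda>u. prox_aug_lag F A b g \<rho> (\<beta> k) (x k) u (y k) (z k)) (x (Suc k))"
proof -
  have "dist_set 0 (wc_subdiff \<rho> (\<lambda>u. prox_aug_lag F A b g \<rho> (\<beta> k) (x k) u (y k) (z k)) (x (Suc k)))
      \<le> ereal (\<epsilon>s k)"
    using iterates by (simp add: dpalm_def)
  from dist_set_attained[OF closed_wc_subdiff this] that show thesis by auto
qed

lemma x_in_X: "x k \<in> X"
proof (cases k)
  case 0
  then show ?thesis using iterates by (simp add: dpalm_def X)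
next
  case (Suc j)
  obtain w where "w \<in> wc_subdiff \<rho> (\<lambda>u. prox_aug_lag F A b g \<rho> (\<beta> j) (x j) u (y j) (z j)) (x (Suc j))"
    by (rule wc_subdiff_prox_obtain)
  then have "\<bar>F (x k) + ereal 0\<bar> \<noteq> \<infinity>"
    by (auto simp: wc_subdiff_def subdiff_def prox_aug_lag_def aug_lag_def Suc)
  then show ?thesis by (auto simp: X edom_def)
qed

text \<open>The term \<open>- \<parallel>z\<parallel>\<^sup>2 / (2 \<beta>)\<close> is left out: it cancels in the decrease at fixed multipliers, and without
  it the function does not increase when an inactive multiplier shrinks.\<close>

definition pen where
  "pen k u = y k \<bullet> (A *v u - b) + \<beta> k / 2 * (norm (A *v u - b))\<^sup>2
     + (\<Sum>i\<in>UNIV. (max (z k $ i + \<beta> k * g u $ i) 0)\<^sup>2) / (2 * \<beta> k)"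

lemma prox_aug_lag_eq:
  "prox_aug_lag F A b g \<rho> (\<beta> k) (x k) u (y k) (z k) =
    h u + ereal (f u + pen k u - (norm (z k))\<^sup>2 / (2 * \<beta> k) + \<rho> * (norm (u - x k))\<^sup>2)"
proof -
  have "(max (g u $ i + z k $ i / \<beta> k) 0)\<^sup>2 * (\<beta> k)\<^sup>2 = (max (z k $ i + \<beta> k * g u $ i) 0)\<^sup>2" for i
  proof -
    have "max (g u $ i + z k $ i / \<beta> k) 0 * \<beta> k = max (z k $ i + \<beta> k * g u $ i) 0"
    proof -
      have "(g u $ i + z k $ i / \<beta> k) * \<beta> k = z k $ i + \<beta> k * g u $ i"
        using \<beta>[of k] by (simp add: field_simps)
      then show ?thesis
        using \<beta>[of k] by (simp only: max_mult_distrib_right) simp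
    qed
    then show ?thesis by (metis power_mult_distrib)
  qed
  then have "(norm (pos_part (g u + (1 / \<beta> k) *\<^sub>R z k)))\<^sup>2 * (\<beta> k)\<^sup>2
      = (\<Sum>i\<in>UNIV. (max (z k $ i + \<beta> k * g u $ i) 0)\<^sup>2)"
    by (simp add: norm_vec_def L2_set_def pos_part_def sum_nonneg sum_distrib_right)
  then have "\<beta> k / 2 * (norm (pos_part (g u + (1 / \<beta> k) *\<^sub>R z k)))\<^sup>2
      = (\<Sum>i\<in>UNIV. (max (z k $ i + \<beta> k * g u $ i) 0)\<^sup>2) / (2 * \<beta> k)"
    using \<beta>[of k] by (simp add: power2_eq_square field_simps)
  then show ?thesis
    unfolding prox_aug_lag_def aug_lag_def F pen_def
    by (cases "h u") (simp_all add: algebra_simps)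
qed

text \<open>At the new iterate the weights on the constraint gradients are exactly the undamped
  multipliers, so \<open>Y\<close> and \<open>Z\<close>, not the damped ones, are the natural KKT
  multipliers.\<close>

lemma pen_has_derivative:
  "(pen k has_derivative (\<lambda>d. d \<bullet> (transpose A *v Y k + transpose (J k) *v Z k))) (at (x (Suc k)))"
proof -
  let ?x = "x (Suc k)"
  have lin: "((*v) A has_derivative (*v) A) (at ?x)"
    by (intro bounded_linear_imp_has_derivative matrix_vector_mul_bounded_linear)
  have comp: "((\<lambda>u. (max (z k $ i + \<beta> k * g u $ i) 0)\<^sup>2) has_derivative
      (\<lambda>d. 2 * Z k $ i * (\<beta> k * (J k *v d) $ i))) (at ?x)" for i
  proof -
    have "((\<lambda>u. z k $ i + \<beta> k * g u $ i) has_derivative (\<lambda>d. \<beta> k * (J k *v d) $ i)) (at ?x)"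
      using g_diff[OF x_in_X[of "Suc k"]]
      by (auto intro!: derivative_eq_intros has_derivative_grad simp: jacobian_component_grad)
    from has_derivative_compose[OF this has_real_derivative_pos_part_sq[unfolded has_field_derivative_def]]
    show ?thesis by (simp add: Z_def)
  qed
  have sum: "((\<lambda>u. (\<Sum>i\<in>UNIV. (max (z k $ i + \<beta> k * g u $ i) 0)\<^sup>2) / (2 * \<beta> k)) has_derivative
      (\<lambda>d. (\<Sum>i\<in>UNIV. 2 * Z k $ i * (\<beta> k * (J k *v d) $ i)) / (2 * \<beta> k))) (at ?x)"
    by (intro bounded_linear.has_derivative[OF bounded_linear_divide] has_derivative_sum comp)
  have "(pen k has_derivative (\<lambda>d. y k \<bullet> (A *v d) + \<beta> k * ((A *v ?x - b) \<bullet> (A *v d))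
      + (\<Sum>i\<in>UNIV. 2 * Z k $ i * (\<beta> k * (J k *v d) $ i)) / (2 * \<beta> k))) (at ?x)"
    unfolding pen_def[abs_def] power2_norm_eq_inner
    by (rule lin sum derivative_eq_intros refl)+ (simp add: fun_eq_iff inner_commute)
  moreover have "y k \<bullet> (A *v d) + \<beta> k * ((A *v ?x - b) \<bullet> (A *v d))
      + (\<Sum>i\<in>UNIV. 2 * Z k $ i * (\<beta> k * (J k *v d) $ i)) / (2 * \<beta> k)
      = d \<bullet> (transpose A *v Y k + transpose (J k) *v Z k)" for d
  proof -
    have "(\<Sum>i\<in>UNIV. 2 * Z k $ i * (\<beta> k * (J k *v d) $ i)) / (2 * \<beta> k) = Z k \<bullet> (J k *v d)"
      using \<beta>[of k] by (simp add: inner_vec_def sum_divide_distrib)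
    moreover have "y k \<bullet> (A *v d) + \<beta> k * ((A *v ?x - b) \<bullet> (A *v d)) = Y k \<bullet> (A *v d)"
      by (simp add: Y_def inner_add_left)
    ultimately show ?thesis
      by (simp only: inner_matrix_transpose inner_add_right inner_commute[of d])
  qed
  ultimately show ?thesis by simp
qed

text \<open>Everything except \<open>h\<close> is differentiable, so the sum rule isolates a
  subgradient of \<open>h\<close>. The multiple \<open>\<rho> *\<^sub>R x\<close> created by the
  quadratic shift cancels the one subtracted in \<open>wc_subdiff\<close>.\<close>

lemma stationarity:
  obtains e w where "e \<in> subdiff h (x (Suc k))" "norm w \<le> \<epsilon>s k"
    "w = grad f (x (Suc k)) + e + (transpose A *v Y k + transpose (J k) *v Z k)
       + (2 * \<rho>) *\<^sub>R (x (Suc k) - x k)"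
proof -
  let ?x = "x (Suc k)"
  obtain w where w: "norm w \<le> \<epsilon>s k"
    "w \<in> wc_subdiff \<rho> (\<lambda>u. prox_aug_lag F A b g \<rho> (\<beta> k) (x k) u (y k) (z k)) ?x"
    by (rule wc_subdiff_prox_obtain)
  define S where "S u = f u + pen k u - (norm (z k))\<^sup>2 / (2 * \<beta> k) + \<rho> * (norm (u - x k))\<^sup>2
      + \<rho> / 2 * (norm u)\<^sup>2" for u
  define s where "s = grad f ?x + (transpose A *v Y k + transpose (J k) *v Z k)
      + (2 * \<rho>) *\<^sub>R (?x - x k) + \<rho> *\<^sub>R ?x"
  have "(S has_derivative (\<lambda>d. d \<bullet> s)) (at ?x)"
    unfolding S_def[abs_def] power2_norm_eq_inner s_def
    by (rule derivative_eq_intros has_derivative_grad[OF f_diff[OF x_in_X]] pen_has_derivative refl)+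
      (simp add: fun_eq_iff inner_commute inner_add_left inner_add_right inner_diff_left
        inner_diff_right algebra_simps)
  moreover have "w + \<rho> *\<^sub>R ?x \<in> subdiff (\<lambda>u. h u + ereal (S u)) ?x"
    using w(2) unfolding wc_subdiff_def prox_aug_lag_eq S_def by (auto simp: add.assoc)
  ultimately have "w + \<rho> *\<^sub>R ?x - s \<in> subdiff h ?x"
    using subdiff_add_smooth[OF h] by blast
  from that[OF this w(1)] show thesis by (simp add: s_def)
qed

section \<open>Damping and the multiplier updates\<close>

lemma r_nonneg: "0 \<le> r k"
  by (simp add: r_def infeas_def)

lemma r_sq: "(r k)\<^sup>2 = (norm (A *v x (Suc k) - b))\<^sup>2 + (norm (pos_part (g (x (Suc k)))))\<^sup>2"
  by (simp add: r_def infeas_def)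

lemma residual_le_r: "norm (A *v x (Suc k) - b) \<le> r k" "norm (pos_part (g (x (Suc k)))) \<le> r k"
  by (rule power2_le_imp_le; simp add: r_sq r_nonneg)+

text \<open>The third bound is the purpose of the damping. For zero residual the step is \<beta>,
  but the product vanishes.\<close>

lemma \<alpha>: "0 \<le> \<alpha> k" "\<alpha> k \<le> \<beta> k" "\<alpha> k * r k \<le> v k"
proof -
  have "min (\<beta> k) (v k / r k) * r k \<le> v k / r k * r k" if "r k \<noteq> 0"
    using r_nonneg by (intro mult_right_mono) auto
  then show "0 \<le> \<alpha> k" "\<alpha> k \<le> \<beta> k" "\<alpha> k * r k \<le> v k"
    using \<beta>[of k] v[of k] r_nonneg[of k] by (auto simp: \<alpha>_def damped_step_def)
qed

lemma y_Suc: "y (Suc k) = y k + \<alpha> k *\<^sub>R (A *v x (Suc k) - b)"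
  using iterates by (simp add: dpalm_def \<alpha>_def r_def Let_def)

lemma z_Suc: "z (Suc k) $ i = z k $ i + \<alpha> k * ((Z k $ i - z k $ i) / \<beta> k)"
proof -
  have "z (Suc k) $ i = z k $ i + \<alpha> k * max (- (z k $ i) / \<beta> k) (g (x (Suc k)) $ i)"
    using iterates by (simp add: dpalm_def \<alpha>_def r_def Let_def)
  also have "max (- (z k $ i) / \<beta> k) (g (x (Suc k)) $ i) = (Z k $ i - z k $ i) / \<beta> k"
    using \<beta>[of k] by (auto simp: Z_def max_def field_simps)
  finally show ?thesis .
qed

lemma p_Suc: "(y (Suc k), z (Suc k)) = (y k, z k) + (\<alpha> k / \<beta> k) *\<^sub>R ((Y k, Z k) - (y k, z k))"
  using \<beta>[of k] by (simp add: y_Suc Y_def vec_eq_iff z_Suc)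

lemma Z_nonneg: "0 \<le> Z k $ i"
  by (simp add: Z_def)

lemma z_nonneg: "0 \<le> z k $ i"
proof (induction k)
  case 0
  then show ?case using iterates by (simp add: dpalm_def)
next
  case (Suc k)
  have "0 \<le> (1 - \<alpha> k / \<beta> k) * z k $ i + \<alpha> k / \<beta> k * Z k $ i"
    using Suc \<alpha>[of k] \<beta>[of k] Z_nonneg by (intro add_nonneg_nonneg mult_nonneg_nonneg) auto
  then show ?case by (simp add: z_Suc algebra_simps diff_divide_distrib)
qed

lemma subspace_range_A: "subspace (range ((*v) A))"
  by (intro linear_subspace_image) auto

text \<open>Feasibility of \<open>xfeas\<close> puts \<open>b\<close> in the range of
  \<open>A\<close>. The equality multipliers therefore never leave that range, where the eigenvalue
  bound on \<open>transpose A\<close> is available.\<close>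

lemma residual_in_range: "A *v u - b \<in> range ((*v) A)"
  using slater(3) by (metis matrix_vector_mult_diff_distrib rangeI)

lemma y_range: "y k \<in> range ((*v) A)"
proof (induction k)
  case 0
  then show ?case using iterates by (simp add: dpalm_def)
next
  case (Suc k)
  then show ?case
    unfolding y_Suc
    by (intro subspace_add subspace_scale subspace_range_A residual_in_range)
qed

lemma Y_range: "Y k \<in> range ((*v) A)"
  unfolding Y_def by (intro subspace_add subspace_scale subspace_range_A residual_in_range y_range)

section \<open>Testing stationarity against points of the domain\<close>

definition test_bound where
  "test_bound = diameter X * (1 + B\<^sub>f + r\<^sub>h + 2 * \<rho> * diameter X)"

text \<open>Pair the stationarity equation with \<open>u - x\<close>. The normal cone part has a
  favourable sign, convexity and \<open>Z \<ge> 0\<close> turn Jacobian terms into constraint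
  differences, and what remains has bounded norm over a displacement of at most the diameter. The
  summand 1 in \<open>test_bound\<close> is the tolerance.\<close>

lemma stationarity_test:
  assumes u: "u \<in> X"
  shows "Y k \<bullet> (A *v x (Suc k) - A *v u)
    + (\<Sum>i\<in>UNIV. Z k $ i * (g (x (Suc k)) $ i - g u $ i)) \<le> test_bound"
proof -
  let ?x = "x (Suc k)"
  obtain e w where e: "e \<in> subdiff h ?x" and w: "norm w \<le> \<epsilon>s k"
    "w = grad f ?x + e + (transpose A *v Y k + transpose (J k) *v Z k) + (2 * \<rho>) *\<^sub>R (?x - x k)"
    by (rule stationarity)
  obtain n q where nq: "e = n + q" "n \<in> normal_cone X ?x" "norm q \<le> r\<^sub>h"
    using e r\<^sub>h(2)[OF x_in_X, of "Suc k"] by (force simp: set_plus_def)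
  define d where "d = u - ?x"
  have n: "n \<bullet> d \<le> 0" using nq(2) u by (simp add: normal_cone_def d_def)
  have d: "norm d \<le> diameter X" unfolding d_def by (intro dist_X u x_in_X)
  have ZJ: "Z k \<bullet> (J k *v d) \<le> (\<Sum>i\<in>UNIV. Z k $ i * (g u $ i - g ?x $ i))"
  proof -
    have "Z k \<bullet> (J k *v d) = (\<Sum>i\<in>UNIV. Z k $ i * (grad (\<lambda>u. g u $ i) ?x \<bullet> d))"
      by (simp add: inner_vec_def jacobian_component_grad[OF g_diff[OF x_in_X]]) (simp add: inner_vec_def mult.commute)
    also have "\<dots> \<le> (\<Sum>i\<in>UNIV. Z k $ i * (g u $ i - g ?x $ i))"
    proof (intro sum_mono mult_left_mono Z_nonneg)
      fix i show "grad (\<lambda>u. g u $ i) ?x \<bullet> d \<le> g u $ i - g ?x $ i"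
        using g_above[OF x_in_X u, of "Suc k" i] by (simp add: d_def)
    qed
    finally show ?thesis .
  qed
  \<comment> \<open>The stationarity equation stripped of its normal cone and multiplier
    terms.\<close>
  define a where "a = grad f ?x + q + (2 * \<rho>) *\<^sub>R (?x - x k) - w"
  have "norm a \<le> B\<^sub>f + r\<^sub>h + 2 * \<rho> * diameter X + 1"
  proof -
    have "norm ((2 * \<rho>) *\<^sub>R (?x - x k)) \<le> 2 * \<rho> * diameter X"
      using f_wc(1) dist_X[OF x_in_X x_in_X, of "Suc k" k] by (simp add: mult_left_mono)
    moreover have "norm w \<le> 1" using w(1) \<epsilon>s[of k] by simp
    ultimately show ?thesis
      unfolding a_def using B\<^sub>f(2)[OF x_in_X, of "Suc k"] nq(3)
      by (intro order_trans[OF norm_triangle_ineq4] add_mono order_trans[OF norm_triangle_ineq])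
  qed
  moreover have "0 \<le> diameter X" using d norm_ge_zero order_trans by blast
  ultimately have "a \<bullet> d \<le> test_bound"
    using mult_mono'[OF _ d, of "norm a" "B\<^sub>f + r\<^sub>h + 2 * \<rho> * diameter X + 1"]
      norm_cauchy_schwarz[of a d]
    by (simp add: test_bound_def algebra_simps)
  moreover have "Y k \<bullet> (A *v d) + Z k \<bullet> (J k *v d) = - (a \<bullet> d) - n \<bullet> d"
    unfolding a_def w(2) nq(1)
    by (simp add: inner_add_left inner_diff_left inner_matrix_transpose del: transpose_matrix_vector)
  moreover have "Y k \<bullet> (A *v ?x - A *v u) = - (Y k \<bullet> (A *v d))"
    by (simp add: d_def inner_diff_right matrix_vector_mult_diff_distrib)
  moreover have "(\<Sum>i\<in>UNIV. Z k $ i * (g ?x $ i - g u $ i))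
      = - (\<Sum>i\<in>UNIV. Z k $ i * (g u $ i - g ?x $ i))"
    by (simp add: algebra_simps flip: sum_negf)
  ultimately show ?thesis using n ZJ by linarith
qed

text \<open>If the maximum in \<open>Z\<close> is active, \<open>Z - z\<close> equals \<beta> times
  the constraint value; otherwise \<open>Z\<close> vanishes on both sides.\<close>

lemma Z_mult_g: "\<beta> k * (Z k $ i * g (x (Suc k)) $ i) = Z k $ i * (Z k $ i - z k $ i)"
  by (simp add: Z_def max_def)

lemma pairing_eq:
  "\<beta> k * (Y k \<bullet> (A *v x (Suc k) - b) + (\<Sum>i\<in>UNIV. Z k $ i * g (x (Suc k)) $ i))
    = (Y k, Z k) \<bullet> ((Y k, Z k) - (y k, z k))"
proof -
  have "\<beta> k * (\<Sum>i\<in>UNIV. Z k $ i * g (x (Suc k)) $ i) = Z k \<bullet> (Z k - z k)"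
    by (simp add: sum_distrib_left Z_mult_g inner_vec_def)
  then show ?thesis by (simp add: Y_def distrib_left)
qed

lemma full_step_bound:
  assumes \<theta>: "\<theta> = dual_bound A \<tau> gmin B" and B: "test_bound \<le> B"
  shows "norm (Y k, Z k) \<le> max (norm (y k, z k)) \<theta>"
proof (cases "norm (Y k, Z k) \<le> norm (y k, z k)")
  case False
  let ?T = "transpose A" and ?x = "x (Suc k)" and ?P = "(Y k, Z k)" and ?p = "(y k, z k)"
  \<comment> \<open>Only here is it used that the full step lengthens the multiplier: it makes the
    pairing of multipliers and residuals nonnegative.\<close>
  have "?P \<bullet> ?p \<le> norm ?P * norm ?P"
    using False by (intro order_trans[OF norm_cauchy_schwarz] mult_left_mono) auto
  then have "0 \<le> ?P \<bullet> (?P - ?p)"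
    unfolding inner_diff_right by (simp add: power2_norm_eq_inner[symmetric] power2_eq_square del: inner_Pair)
  then have pair: "0 \<le> Y k \<bullet> (A *v ?x - b) + (\<Sum>i\<in>UNIV. Z k $ i * g ?x $ i)"
    using \<beta>[of k] unfolding pairing_eq[symmetric] by (simp add: zero_le_mult_iff)
  \<comment> \<open>The shift against \<open>transpose A *v Y k\<close> gains \<tau> times its norm
    in the equality term, while \<open>u\<close> stays in the Slater ball. If that vector is 0,
    \<open>sgn\<close> gives 0 and nothing is lost.\<close>
  define u where "u = xfeas - \<tau> *\<^sub>R sgn (?T *v Y k)"
  have du: "norm (u - xfeas) \<le> \<tau>"
    using slater(2) by (simp add: u_def norm_sgn)
  then have "u \<in> cball xfeas \<tau>" by (simp add: dist_norm norm_minus_commute)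
  then have uX: "u \<in> X" using slater(1) by blast
  have fX: "xfeas \<in> X" using slater(1,2) by auto
  have gu: "gmin / 2 \<le> - g u $ i" for i
  proof -
    have "g u $ i \<le> g xfeas $ i + B\<^sub>g * norm (u - xfeas)"
      using B\<^sub>g(2)[OF uX fX, of i] by linarith
    also have "\<dots> \<le> - gmin + B\<^sub>g * \<tau>"
      using du B\<^sub>g(1) slater(5)[of i] by (intro add_mono mult_left_mono) auto
    finally show ?thesis using slater(6) by linarith
  qed
  have Yu: "Y k \<bullet> (A *v ?x - A *v u) = Y k \<bullet> (A *v ?x - b) + \<tau> * norm (?T *v Y k)"
  proof -
    have "Y k \<bullet> (A *v sgn (?T *v Y k)) = (?T *v Y k) \<bullet> sgn (?T *v Y k)"
      by (rule inner_matrix_transpose[symmetric])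
    also have "\<dots> = norm (?T *v Y k)"
      by (cases "?T *v Y k = 0")
        (simp_all add: sgn_div_norm power2_norm_eq_inner[symmetric] power2_eq_square
          del: transpose_matrix_vector)
    finally show ?thesis
      unfolding u_def
      by (simp add: matrix_vector_mult_diff_distrib matrix_vector_mult_scaleR slater(3)
          inner_diff_right del: transpose_matrix_vector)
  qed
  have Zu: "(\<Sum>i\<in>UNIV. Z k $ i * g ?x $ i) + gmin / 2 * (\<Sum>i\<in>UNIV. Z k $ i)
      \<le> (\<Sum>i\<in>UNIV. Z k $ i * (g ?x $ i - g u $ i))"
  proof -
    have "(\<Sum>i\<in>UNIV. Z k $ i * (gmin / 2)) \<le> (\<Sum>i\<in>UNIV. Z k $ i * - g u $ i)"
      by (intro sum_mono mult_left_mono gu Z_nonneg)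
    then show ?thesis
      by (simp add: sum_distrib_left sum_distrib_right[symmetric] right_diff_distrib sum_subtractf sum_negf mult.commute)
  qed
  have main: "\<tau> * norm (?T *v Y k) + gmin / 2 * norm (Z k) \<le> B"
  proof -
    have "gmin / 2 * norm (Z k) \<le> gmin / 2 * (\<Sum>i\<in>UNIV. Z k $ i)"
      using slater(4) norm_le_sum_nonneg_cart[of "Z k"] Z_nonneg by (intro mult_left_mono) auto
    then show ?thesis
      using stationarity_test[OF uX, of k] Yu Zu pair B by linarith
  qed
  have "norm ?P \<le> \<theta>"
  proof (cases "A = 0")
    case True
    \<comment> \<open>For \<open>A = 0\<close> the range is trivial, which matches the denominator
      \<open>gmin / 2\<close> chosen in \<open>dual_bound\<close>.\<close>
    then have "Y k = 0" using Y_range[of k] by auto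
    then show ?thesis using main slater(4) True by (simp add: \<theta> dual_bound_def norm_Pair field_simps)
  next
    case False
    let ?l = "sqrt (lambda_min_pos (A ** ?T))"
    let ?c = "min (\<tau> * ?l) (gmin / 2)"
    have c: "0 < ?c" using lambda_min_pos_gram(1)[OF False] slater by simp
    have "norm ?P \<le> norm (Y k) + norm (Z k)"
      by (simp add: norm_Pair sqrt_sum_squares_le_sum)
    then have "?c * norm ?P \<le> ?c * norm (Y k) + ?c * norm (Z k)"
      using c by (simp only: distrib_left[symmetric] mult_left_mono less_imp_le)
    also have "\<dots> \<le> \<tau> * ?l * norm (Y k) + gmin / 2 * norm (Z k)"
      by (intro add_mono mult_right_mono) auto
    also have "\<tau> * ?l * norm (Y k) \<le> \<tau> * norm (?T *v Y k)"
      using mult_left_mono[OF lambda_min_pos_gram(2)[OF False Y_range[of k]], of \<tau>] slater(2)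
      by (simp add: mult.assoc)
    also note main
    finally have "?c * norm ?P \<le> B" by simp
    then show ?thesis using c False by (simp add: \<theta> dual_bound_def pos_le_divide_eq mult.commute)
  qed
  then show ?thesis by simp
qed simp

lemma multipliers_bounded:
  assumes \<theta>: "\<theta> = dual_bound A \<tau> gmin B" and B: "test_bound \<le> B"
    and Bp: "B\<^sub>p = max (norm (y 0, z 0)) \<theta>"
  shows "norm (y k, z k) \<le> B\<^sub>p" and "norm (Y k, Z k) \<le> B\<^sub>p"
proof -
  have step: "norm (Y k, Z k) \<le> B\<^sub>p" if "norm (y k, z k) \<le> B\<^sub>p" for k
    using full_step_bound[OF \<theta> B, of k] that Bp by simp
  show 1: "norm (y k, z k) \<le> B\<^sub>p"
  proof (induction k)
    case (Suc k)
    let ?t = "\<alpha> k / \<beta> k"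
    have t: "0 \<le> ?t" "?t \<le> 1" using \<alpha>[of k] \<beta>[of k] by auto
    have "(1 - ?t) *\<^sub>R (y k, z k) + ?t *\<^sub>R (Y k, Z k) \<in> cball 0 B\<^sub>p"
      using Suc step[OF Suc] t by (intro convexD[OF convex_cball]) auto
    moreover have "(y (Suc k), z (Suc k)) = (1 - ?t) *\<^sub>R (y k, z k) + ?t *\<^sub>R (Y k, Z k)"
      unfolding p_Suc by (simp only: scaleR_diff_left scaleR_diff_right scaleR_one algebra_simps)
    ultimately show ?case by simp
  qed (simp add: Bp)
  show "norm (Y k, Z k) \<le> B\<^sub>p" by (rule step[OF 1])
qed

end

subsection \<open>Decrease of the augmented Lagrangian\<close>

locale dpalm_bounded = dpalm_run +
  fixes B\<^sub>p :: real
  assumes p_le: "\<And>k. norm (y k, z k) \<le> B\<^sub>p" and P_le: "\<And>k. norm (Y k, Z k) \<le> B\<^sub>p"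
begin

section \<open>Infeasibility, complementarity and the KKT test\<close>

lemma B\<^sub>p_nonneg: "0 \<le> B\<^sub>p"
  using p_le[of 0] norm_ge_zero order_trans by blast

lemma components_le:
  "norm (y k) \<le> B\<^sub>p" "norm (z k) \<le> B\<^sub>p" "norm (Y k) \<le> B\<^sub>p" "norm (Z k) \<le> B\<^sub>p"
  using p_le[of k] P_le[of k] norm_fst_le norm_snd_le order_trans by blast+

lemma step_le: "norm ((Y k, Z k) - (y k, z k)) \<le> 2 * B\<^sub>p"
  using norm_triangle_ineq4[of "(Y k, Z k)" "(y k, z k)"] p_le[of k] P_le[of k] by linarith

text \<open>The residual can be read off the full multiplier step: since \<open>z \<ge> 0\<close>,
  the maximum in \<open>Z\<close> never truncates a violated constraint, so there
  \<open>Z - z\<close> is \<beta> times the violation.\<close>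

lemma r_le: "\<beta> k * r k \<le> 2 * B\<^sub>p"
proof -
  let ?x = "x (Suc k)"
  have "(\<beta> k)\<^sup>2 * (pos_part (g ?x) $ i)\<^sup>2 \<le> ((Z k - z k) $ i)\<^sup>2" for i
  proof (cases "0 \<le> g ?x $ i")
    case True
    then have "0 \<le> z k $ i + \<beta> k * g ?x $ i"
      using \<beta>[of k] z_nonneg[of k i] by simp
    then have "(Z k - z k) $ i = \<beta> k * g ?x $ i"
      by (simp add: Z_def)
    then show ?thesis using True by (simp add: pos_part_def power_mult_distrib)
  qed (simp add: pos_part_def)
  then have "(\<beta> k)\<^sup>2 * (norm (pos_part (g ?x)))\<^sup>2 \<le> (norm (Z k - z k))\<^sup>2"
    unfolding norm_sq_vec sum_distrib_left by (rule sum_mono)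
  moreover have "(\<beta> k)\<^sup>2 * (norm (A *v ?x - b))\<^sup>2 = (norm (Y k - y k))\<^sup>2"
    by (simp add: Y_def power_mult_distrib)
  ultimately have "(\<beta> k * r k)\<^sup>2 \<le> (norm ((Y k, Z k) - (y k, z k)))\<^sup>2"
    by (simp add: norm_sq_Pair power_mult_distrib r_sq distrib_left)
  then have "\<beta> k * r k \<le> norm ((Y k, Z k) - (y k, z k))"
    by (rule power2_le_imp_le) simp
  then show ?thesis using step_le[of k] by linarith
qed

text \<open>By \<open>Z_mult_g\<close> the products are \<open>Z * (Z - z)\<close> componentwise;
  the Cauchy-Schwarz inequality then leaves norms at most \<open>B\<^sub>p\<close> and
  \<open>2 * B\<^sub>p\<close>.\<close>

lemma complementarity_le: "\<beta> k * (\<Sum>i\<in>UNIV. \<bar>Z k $ i * g (x (Suc k)) $ i\<bar>) \<le> 2 * B\<^sub>p\<^sup>2"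
proof -
  have "\<beta> k * (\<Sum>i\<in>UNIV. \<bar>Z k $ i * g (x (Suc k)) $ i\<bar>)
      = (\<Sum>i\<in>UNIV. \<bar>\<beta> k * (Z k $ i * g (x (Suc k)) $ i)\<bar>)"
    using \<beta>[of k] by (simp add: sum_distrib_left abs_mult)
  also have "\<dots> = (\<Sum>i\<in>UNIV. \<bar>Z k $ i\<bar> * \<bar>(Z k - z k) $ i\<bar>)"
    by (simp add: Z_mult_g abs_mult)
  also have "\<dots> \<le> L2_set (($) (Z k)) UNIV * L2_set (($) (Z k - z k)) UNIV"
    by (rule L2_set_mult_ineq)
  also have "\<dots> = norm (Z k) * norm (Z k - z k)"
    by (simp add: norm_vec_def L2_set_def)
  also have "\<dots> \<le> B\<^sub>p * (2 * B\<^sub>p)"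
  proof (rule mult_mono)
    show "norm (Z k - z k) \<le> 2 * B\<^sub>p"
      using norm_snd_le[of "Z k - z k" "Y k - y k"] step_le[of k] by simp
  qed (use components_le B\<^sub>p_nonneg in auto)
  finally show ?thesis by (simp add: power2_eq_square)
qed

lemma eps_kktI:
  assumes step: "\<epsilon>s k + 2 * \<rho> * norm (x (Suc k) - x k) \<le> \<epsilon>"
    and \<beta>_large: "2 * B\<^sub>p \<le> \<beta> k * \<epsilon>" "2 * B\<^sub>p\<^sup>2 \<le> \<beta> k * \<epsilon>"
  shows "eps_kkt F A b g \<rho> \<epsilon> (x (Suc k))"
proof -
  let ?x = "x (Suc k)"
  obtain e w where e: "e \<in> subdiff h ?x" and w: "norm w \<le> \<epsilon>s k"
    "w = grad f ?x + e + (transpose A *v Y k + transpose (J k) *v Z k) + (2 * \<rho>) *\<^sub>R (?x - x k)"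
    by (rule stationarity)
  let ?S = "(\<lambda>v. v + transpose (J k) *v Z k + transpose A *v Y k) ` wc_subdiff \<rho> F ?x"
  \<comment> \<open>Moving the proximal term to the other side leaves a KKT residual consisting of
    the tolerance and the step length.\<close>
  have "w - (2 * \<rho>) *\<^sub>R (?x - x k) \<in> ?S"
    by (rule image_eqI[OF _ wc_subdiff_F[OF e x_in_X]]) (simp add: w(2) algebra_simps)
  then have INF: "dist_set 0 ?S \<le> ereal (dist 0 (w - (2 * \<rho>) *\<^sub>R (?x - x k)))"
    unfolding dist_set_def by (rule INF_lower)
  have "norm (w - (2 * \<rho>) *\<^sub>R (?x - x k)) \<le> norm w + norm ((2 * \<rho>) *\<^sub>R (?x - x k))"
    by (rule norm_triangle_ineq4)
  then have "dist 0 (w - (2 * \<rho>) *\<^sub>R (?x - x k)) \<le> \<epsilon>"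
    using w(1) step f_wc(1) by simp
  then have "dist_set 0 ?S \<le> ereal \<epsilon>"
    by (intro order_trans[OF INF]) simp
  moreover have "r k \<le> \<epsilon>"
    using order_trans[OF r_le[of k] \<beta>_large(1)] \<beta>[of k] by simp
  moreover have "(\<Sum>i\<in>UNIV. \<bar>Z k $ i * g ?x $ i\<bar>) \<le> \<epsilon>"
    using order_trans[OF complementarity_le[of k] \<beta>_large(2)] \<beta>[of k] by simp
  moreover have "?x \<in> edom F" using x_in_X X by blast
  ultimately show ?thesis
    unfolding eps_kkt_def r_def using Z_nonneg[of k]
    by (intro conjI exI[of _ "Y k"] exI[of _ "Z k"]) auto
qed

section \<open>Descent and drift of the merit function\<close>

definition M where "M k u = f u + real_of_ereal (h u) + pen k u"

text \<open>Tangent inequality of a convex function: the squared positive part is convex and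
  nondecreasing, so composing it with convex constraints keeps the linearisation below.\<close>

lemma pen_above:
  assumes u: "u \<in> X"
  shows "pen k (x (Suc k)) + (transpose A *v Y k + transpose (J k) *v Z k) \<bullet> (u - x (Suc k))
    \<le> pen k u"
proof -
  let ?x = "x (Suc k)"
  define d where "d = u - ?x"
  have comp: "(max (z k $ i + \<beta> k * g ?x $ i) 0)\<^sup>2 + 2 * \<beta> k * (Z k $ i * (J k *v d) $ i)
      \<le> (max (z k $ i + \<beta> k * g u $ i) 0)\<^sup>2" for i
  proof -
    have "(J k *v d) $ i \<le> g u $ i - g ?x $ i"
      using g_above[OF x_in_X u, of "Suc k" i]
      by (simp add: d_def jacobian_component_grad[OF g_diff[OF x_in_X]] inner_commute)
    then have "2 * Z k $ i * (\<beta> k * (J k *v d) $ i) \<le> 2 * Z k $ i * (\<beta> k * (g u $ i - g ?x $ i))"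
      using \<beta>[of k] Z_nonneg by (intro mult_left_mono) auto
    then show ?thesis
      using pos_part_sq_tangent(2)[of "z k $ i + \<beta> k * g ?x $ i" "z k $ i + \<beta> k * g u $ i"]
      by (simp add: Z_def algebra_simps)
  qed
  have "(\<Sum>i\<in>UNIV. (max (z k $ i + \<beta> k * g ?x $ i) 0)\<^sup>2) + 2 * \<beta> k * (Z k \<bullet> (J k *v d))
      \<le> (\<Sum>i\<in>UNIV. (max (z k $ i + \<beta> k * g u $ i) 0)\<^sup>2)"
    using sum_mono[of UNIV, OF comp] by (simp add: sum.distrib sum_distrib_left inner_vec_def)
  then have "((\<Sum>i\<in>UNIV. (max (z k $ i + \<beta> k * g ?x $ i) 0)\<^sup>2) + 2 * \<beta> k * (Z k \<bullet> (J k *v d))) / (2 * \<beta> k)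
      \<le> (\<Sum>i\<in>UNIV. (max (z k $ i + \<beta> k * g u $ i) 0)\<^sup>2) / (2 * \<beta> k)"
    using \<beta>[of k] by (intro divide_right_mono) auto
  then have S: "(\<Sum>i\<in>UNIV. (max (z k $ i + \<beta> k * g ?x $ i) 0)\<^sup>2) / (2 * \<beta> k) + Z k \<bullet> (J k *v d)
      \<le> (\<Sum>i\<in>UNIV. (max (z k $ i + \<beta> k * g u $ i) 0)\<^sup>2) / (2 * \<beta> k)"
    using \<beta>[of k] by (simp add: add_divide_distrib)
  have Au: "A *v u - b = (A *v ?x - b) + A *v d"
    by (simp add: d_def matrix_vector_mult_diff_distrib)
  have "\<beta> k / 2 * (norm (A *v u - b))\<^sup>2 = \<beta> k / 2 * (norm (A *v ?x - b))\<^sup>2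
      + \<beta> k * ((A *v ?x - b) \<bullet> (A *v d)) + \<beta> k / 2 * (norm (A *v d))\<^sup>2"
    unfolding Au power2_norm_eq_inner
    by (simp add: inner_add_left inner_add_right inner_commute algebra_simps)
  moreover have "0 \<le> \<beta> k / 2 * (norm (A *v d))\<^sup>2" using \<beta>[of k] by simp
  moreover have "y k \<bullet> (A *v u - b) = y k \<bullet> (A *v ?x - b) + y k \<bullet> (A *v d)"
    unfolding Au inner_add_right ..
  moreover have "(transpose A *v Y k + transpose (J k) *v Z k) \<bullet> d
      = y k \<bullet> (A *v d) + \<beta> k * ((A *v ?x - b) \<bullet> (A *v d)) + Z k \<bullet> (J k *v d)"
    unfolding inner_add_left inner_matrix_transpose Y_def inner_scaleR_left ..
  ultimately show ?thesis
    using S unfolding pen_def d_def[symmetric] by linarith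
qed

text \<open>Testing stationarity with the reversed step, the proximal term yields
  \<open>2 * \<rho>\<close> times its squared length and weak convexity costs
  \<open>\<rho> / 2\<close>, leaving \<open>3 / 2 * \<rho>\<close>.\<close>

lemma descent:
  "3 / 2 * \<rho> * (norm (x (Suc k) - x k))\<^sup>2 - \<epsilon>s k * norm (x (Suc k) - x k) \<le> M k (x k) - M k (x (Suc k))"
proof -
  let ?x = "x (Suc k)"
  obtain e w where e: "e \<in> subdiff h ?x" and w: "norm w \<le> \<epsilon>s k"
    "w = grad f ?x + e + (transpose A *v Y k + transpose (J k) *v Z k) + (2 * \<rho>) *\<^sub>R (?x - x k)"
    by (rule stationarity)
  define d where "d = x k - ?x"
  have dn: "norm (?x - x k) = norm d" by (simp add: d_def norm_minus_commute)
  have "h ?x + ereal (e \<bullet> d) \<le> h (x k)" using e by (simp add: subdiff_def d_def)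
  then have "ereal (real_of_ereal (h ?x) + e \<bullet> d) \<le> ereal (real_of_ereal (h (x k)))"
    using h_finite[OF x_in_X[of k]] h_finite[OF x_in_X[of "Suc k"]] by (metis plus_ereal.simps(1))
  then have hd: "real_of_ereal (h ?x) + e \<bullet> d \<le> real_of_ereal (h (x k))" by simp
  have "w \<bullet> d = grad f ?x \<bullet> d + e \<bullet> d + (transpose A *v Y k + transpose (J k) *v Z k) \<bullet> d
      - 2 * \<rho> * (norm d)\<^sup>2"
    unfolding w(2) d_def inner_add_left power2_norm_eq_inner
    by (simp add: inner_diff_left inner_diff_right algebra_simps)
  moreover have "- (\<epsilon>s k * norm d) \<le> w \<bullet> d"
    using Cauchy_Schwarz_ineq2[of w d] mult_right_mono[OF w(1), of "norm d"] by simp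
  ultimately show ?thesis
    using hd f_above[OF x_in_X x_in_X, of "Suc k" k] pen_above[OF x_in_X, of k k]
    unfolding M_def dn d_def[symmetric] by linarith
qed

text \<open>The three terms are the growth of the penalty, the multiplier motion along the
  violation, and the cross term with the old \<open>z\<close>. The factor 3/2 adds 1 from the linear
  term and 1/2 from the square of the new multiplier.\<close>

lemma M_change:
  assumes mono: "\<beta> k \<le> \<beta> (Suc k)"
  shows "M (Suc k) (x (Suc k)) - M k (x (Suc k))
    \<le> (\<beta> (Suc k) - \<beta> k) / 2 * (r k)\<^sup>2 + 3 / 2 * (v k * r k) + v k * B\<^sub>p / \<beta> k"
proof -
  let ?x = "x (Suc k)" and ?\<beta> = "\<beta> (Suc k)"
  have \<beta>p: "0 < \<beta> k" "0 < ?\<beta>" using \<beta> by auto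
  define gp where "gp i = pos_part (g ?x) $ i" for i
  have gp0: "0 \<le> gp i" for i by (simp add: gp_def pos_part_def)
  have comp: "(max (z (Suc k) $ i + ?\<beta> * g ?x $ i) 0)\<^sup>2 / (2 * ?\<beta>)
      - (max (z k $ i + \<beta> k * g ?x $ i) 0)\<^sup>2 / (2 * \<beta> k)
      \<le> ((?\<beta> - \<beta> k) / 2 + 3 / 2 * \<alpha> k) * (gp i)\<^sup>2 + \<alpha> k / \<beta> k * (gp i * z k $ i)" for i
  proof (cases "0 \<le> g ?x $ i")
    case True
    let ?g = "g ?x $ i" and ?z = "z k $ i" and ?z' = "z (Suc k) $ i"
    have "0 \<le> ?z + \<beta> k * ?g"
      using True \<beta>p(1) z_nonneg[of k i] by simp
    then have z': "?z' = ?z + \<alpha> k * ?g"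
      using \<beta>p(1) by (simp add: z_Suc Z_def)
    have sq: "(z0 + c * ?g)\<^sup>2 / (2 * c) = z0\<^sup>2 / (2 * c) + z0 * ?g + c / 2 * ?g\<^sup>2" if "c > 0" for z0 c
      using that by (simp add: power2_eq_square field_simps)
    have "?z'\<^sup>2 / (2 * ?\<beta>) \<le> ?z'\<^sup>2 / (2 * \<beta> k)"
      using mono \<beta>p by (intro divide_left_mono) auto
    also have "?z'\<^sup>2 / (2 * \<beta> k) = ?z\<^sup>2 / (2 * \<beta> k) + \<alpha> k / \<beta> k * (?g * ?z) + \<alpha> k / \<beta> k * (\<alpha> k / 2 * ?g\<^sup>2)"
      unfolding z' using \<beta>p by (simp add: power2_eq_square field_simps)
    also have "\<alpha> k / \<beta> k * (\<alpha> k / 2 * ?g\<^sup>2) \<le> 1 * (\<alpha> k / 2 * ?g\<^sup>2)"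
      using \<alpha>[of k] \<beta>p by (intro mult_right_mono) auto
    finally have sq_le: "?z'\<^sup>2 / (2 * ?\<beta>) \<le> ?z\<^sup>2 / (2 * \<beta> k) + \<alpha> k / \<beta> k * (?g * ?z) + \<alpha> k / 2 * ?g\<^sup>2"
      by simp
    have pos: "max (?z + \<beta> k * ?g) 0 = ?z + \<beta> k * ?g" "max (?z' + ?\<beta> * ?g) 0 = ?z' + ?\<beta> * ?g"
      using True \<beta>p z_nonneg[of _ i] by (simp_all add: add_nonneg_nonneg max_absorb1)
    have gpi: "gp i = ?g" using True by (simp add: gp_def pos_part_def)
    have "?z' * ?g = ?z * ?g + \<alpha> k * ?g\<^sup>2"
      by (simp add: z' power2_eq_square algebra_simps)
    moreover have "((?\<beta> - \<beta> k) / 2 + 3 / 2 * \<alpha> k) * ?g\<^sup>2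
        = ?\<beta> / 2 * ?g\<^sup>2 - \<beta> k / 2 * ?g\<^sup>2 + \<alpha> k / 2 * ?g\<^sup>2 + \<alpha> k * ?g\<^sup>2"
      by (simp add: field_simps)
    ultimately show ?thesis
      using sq_le sq[OF \<beta>p(1), of ?z] sq[OF \<beta>p(2), of ?z'] unfolding pos gpi by linarith
  next
    \<comment> \<open>A negative constraint value lowers both the multiplier and the shifted
      argument, so this component cannot increase.\<close>
    case False
    then have g0: "g ?x $ i \<le> 0" and gpi: "gp i = 0" by (auto simp: gp_def pos_part_def)
    have "z k $ i + \<beta> k * g ?x $ i \<le> z k $ i"
      using g0 \<beta>p(1) by (simp add: mult_nonneg_nonpos)
    then have "Z k $ i \<le> z k $ i" using z_nonneg[of k i] by (simp add: Z_def)
    then have "z (Suc k) $ i \<le> z k $ i"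
      using \<alpha>(1)[of k] \<beta>p(1) by (simp add: z_Suc mult_nonneg_nonpos divide_nonpos_pos)
    moreover have "?\<beta> * g ?x $ i \<le> \<beta> k * g ?x $ i"
      using mono g0 by (rule mult_right_mono_neg)
    ultimately have "max (z (Suc k) $ i + ?\<beta> * g ?x $ i) 0 \<le> max (z k $ i + \<beta> k * g ?x $ i) 0"
      by linarith
    then have "(max (z (Suc k) $ i + ?\<beta> * g ?x $ i) 0)\<^sup>2 / (2 * ?\<beta>)
        \<le> (max (z k $ i + \<beta> k * g ?x $ i) 0)\<^sup>2 / (2 * \<beta> k)"
      using mono \<beta>p by (intro frac_le power_mono) auto
    then show ?thesis using gpi by simp
  qed
  let ?N = "(norm (pos_part (g ?x)))\<^sup>2" and ?R = "(norm (A *v ?x - b))\<^sup>2"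
  let ?G = "(\<Sum>i\<in>UNIV. gp i * z k $ i)"
  have "(\<Sum>i\<in>UNIV. (max (z (Suc k) $ i + ?\<beta> * g ?x $ i) 0)\<^sup>2) / (2 * ?\<beta>)
      - (\<Sum>i\<in>UNIV. (max (z k $ i + \<beta> k * g ?x $ i) 0)\<^sup>2) / (2 * \<beta> k)
      \<le> (\<Sum>i\<in>UNIV. ((?\<beta> - \<beta> k) / 2 + 3 / 2 * \<alpha> k) * (gp i)\<^sup>2 + \<alpha> k / \<beta> k * (gp i * z k $ i))"
    unfolding sum_divide_distrib sum_subtractf[symmetric] by (intro sum_mono comp)
  also have "\<dots> = ((?\<beta> - \<beta> k) / 2 + 3 / 2 * \<alpha> k) * ?N + \<alpha> k / \<beta> k * ?G"
    by (simp add: sum.distrib sum_distrib_left norm_sq_vec gp_def)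
  finally have ineq: "(\<Sum>i\<in>UNIV. (max (z (Suc k) $ i + ?\<beta> * g ?x $ i) 0)\<^sup>2) / (2 * ?\<beta>)
      - (\<Sum>i\<in>UNIV. (max (z k $ i + \<beta> k * g ?x $ i) 0)\<^sup>2) / (2 * \<beta> k)
      \<le> ((?\<beta> - \<beta> k) / 2 + 3 / 2 * \<alpha> k) * ?N + \<alpha> k / \<beta> k * ?G" .
  have "y (Suc k) \<bullet> (A *v ?x - b) = y k \<bullet> (A *v ?x - b) + \<alpha> k * ?R"
    by (simp add: y_Suc inner_add_left power2_norm_eq_inner)
  moreover have "\<alpha> k * ?R \<le> 3 / 2 * \<alpha> k * ?R" using \<alpha>(1)[of k] by (simp add: mult_right_mono)
  moreover have "((?\<beta> - \<beta> k) / 2 + 3 / 2 * \<alpha> k) * ?R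
      = ?\<beta> / 2 * ?R - \<beta> k / 2 * ?R + 3 / 2 * \<alpha> k * ?R"
    by (simp add: field_simps)
  ultimately have "M (Suc k) ?x - M k ?x
      \<le> ((?\<beta> - \<beta> k) / 2 + 3 / 2 * \<alpha> k) * ?R + ((?\<beta> - \<beta> k) / 2 + 3 / 2 * \<alpha> k) * ?N + \<alpha> k / \<beta> k * ?G"
    using ineq unfolding M_def pen_def by linarith
  also have "\<dots> = (?\<beta> - \<beta> k) / 2 * (r k)\<^sup>2 + 3 / 2 * (\<alpha> k * r k * r k) + \<alpha> k * ?G / \<beta> k"
  proof -
    have rr: "\<alpha> k * r k * r k = \<alpha> k * (r k)\<^sup>2" by (simp add: power2_eq_square)
    show ?thesis unfolding rr r_sq by (simp add: field_simps)
  qed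
  also have "\<dots> \<le> (?\<beta> - \<beta> k) / 2 * (r k)\<^sup>2 + 3 / 2 * (v k * r k) + v k * B\<^sub>p / \<beta> k"
  proof (intro add_mono mult_left_mono mult_right_mono divide_right_mono order_refl)
    have "?G = pos_part (g ?x) \<bullet> z k" by (simp add: gp_def inner_vec_def)
    also have "\<dots> \<le> r k * B\<^sub>p"
      using norm_cauchy_schwarz[of "pos_part (g ?x)" "z k"] components_le(2)[of k] residual_le_r(2)[of k]
        mult_mono[OF residual_le_r(2)[of k] components_le(2)[of k]] r_nonneg[of k] by simp
    finally have "\<alpha> k * ?G \<le> (\<alpha> k * r k) * B\<^sub>p"
      using \<alpha>(1)[of k] by (simp add: mult.assoc mult_left_mono)
    also have "\<dots> \<le> v k * B\<^sub>p" by (intro mult_right_mono \<alpha>(3) B\<^sub>p_nonneg)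
    finally show "\<alpha> k * ?G \<le> v k * B\<^sub>p" .
  qed (use \<alpha> r_nonneg \<beta>p mono in \<open>auto intro: less_imp_le\<close>)
  finally show ?thesis .
qed

lemma pen_ge: "- (B\<^sub>p * (norm (A *v u - b))) \<le> pen k u"
proof -
  have "\<bar>y k \<bullet> (A *v u - b)\<bar> \<le> norm (y k) * norm (A *v u - b)"
    by (rule Cauchy_Schwarz_ineq2)
  also have "\<dots> \<le> B\<^sub>p * norm (A *v u - b)" by (intro mult_right_mono components_le) simp
  finally have "- (B\<^sub>p * (norm (A *v u - b))) \<le> y k \<bullet> (A *v u - b)" by linarith
  moreover have "0 \<le> \<beta> k / 2 * (norm (A *v u - b))\<^sup>2
      + (\<Sum>i\<in>UNIV. (max (z k $ i + \<beta> k * g u $ i) 0)\<^sup>2) / (2 * \<beta> k)"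
    using \<beta>[of k] by (intro add_nonneg_nonneg divide_nonneg_pos sum_nonneg) auto
  ultimately show ?thesis unfolding pen_def by linarith
qed

text \<open>Indices are mixed on purpose: the telescoping sum starts at \<open>x (Suc k)\<close>
  with the new parameters, but the residual there is \<open>r k\<close>, controlled by the old
  penalty.\<close>

lemma pen_le:
  "pen (Suc k) (x (Suc k)) \<le> B\<^sub>p * r k + \<beta> (Suc k) * (r k)\<^sup>2 + B\<^sub>p\<^sup>2 / \<beta> (Suc k)"
proof -
  let ?x = "x (Suc k)" and ?\<beta> = "\<beta> (Suc k)"
  have \<beta>p: "0 < ?\<beta>" using \<beta> .
  have comp: "(max (z (Suc k) $ i + ?\<beta> * g ?x $ i) 0)\<^sup>2
      \<le> 2 * (z (Suc k) $ i)\<^sup>2 + 2 * ?\<beta>\<^sup>2 * (pos_part (g ?x) $ i)\<^sup>2" for i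
  proof -
    let ?p = "pos_part (g ?x) $ i"
    have "?\<beta> * g ?x $ i \<le> ?\<beta> * ?p" "0 \<le> ?\<beta> * ?p" 
      using \<beta>p by (auto simp: pos_part_def intro: mult_left_mono)
    then have "max (z (Suc k) $ i + ?\<beta> * g ?x $ i) 0 \<le> z (Suc k) $ i + ?\<beta> * ?p"
      using z_nonneg[of "Suc k" i] by linarith
    then have "(max (z (Suc k) $ i + ?\<beta> * g ?x $ i) 0)\<^sup>2 \<le> (z (Suc k) $ i + ?\<beta> * ?p)\<^sup>2"
      by (intro power_mono) auto
    also have "\<dots> \<le> 2 * (z (Suc k) $ i)\<^sup>2 + 2 * (?\<beta> * ?p)\<^sup>2"
      using sum_squares_bound[of "z (Suc k) $ i" "?\<beta> * ?p"] by (simp add: power2_sum)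
    finally show ?thesis by (simp add: power_mult_distrib)
  qed
  have "(\<Sum>i\<in>UNIV. (max (z (Suc k) $ i + ?\<beta> * g ?x $ i) 0)\<^sup>2)
      \<le> 2 * (norm (z (Suc k)))\<^sup>2 + 2 * ?\<beta>\<^sup>2 * (norm (pos_part (g ?x)))\<^sup>2"
    unfolding norm_sq_vec sum_distrib_left sum.distrib[symmetric] by (intro sum_mono comp)
  then have "(\<Sum>i\<in>UNIV. (max (z (Suc k) $ i + ?\<beta> * g ?x $ i) 0)\<^sup>2) / (2 * ?\<beta>)
      \<le> (2 * (norm (z (Suc k)))\<^sup>2 + 2 * ?\<beta>\<^sup>2 * (norm (pos_part (g ?x)))\<^sup>2) / (2 * ?\<beta>)"
    using \<beta>p by (intro divide_right_mono) auto
  also have "\<dots> = (norm (z (Suc k)))\<^sup>2 / ?\<beta> + ?\<beta> * (norm (pos_part (g ?x)))\<^sup>2"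
    using \<beta>p by (simp add: power2_eq_square field_simps)
  also have "(norm (z (Suc k)))\<^sup>2 / ?\<beta> \<le> B\<^sub>p\<^sup>2 / ?\<beta>"
    using \<beta>p by (intro divide_right_mono power_mono components_le) auto
  finally have Zp: "(\<Sum>i\<in>UNIV. (max (z (Suc k) $ i + ?\<beta> * g ?x $ i) 0)\<^sup>2) / (2 * ?\<beta>)
      \<le> B\<^sub>p\<^sup>2 / ?\<beta> + ?\<beta> * (norm (pos_part (g ?x)))\<^sup>2" by simp
  have "y (Suc k) \<bullet> (A *v ?x - b) \<le> norm (y (Suc k)) * norm (A *v ?x - b)"
    by (rule norm_cauchy_schwarz)
  also have "\<dots> \<le> B\<^sub>p * r k"
    using B\<^sub>p_nonneg by (intro mult_mono components_le residual_le_r) auto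
  finally have "y (Suc k) \<bullet> (A *v ?x - b) \<le> B\<^sub>p * r k" .
  moreover have "?\<beta> / 2 * (norm (A *v ?x - b))\<^sup>2 \<le> ?\<beta> * (norm (A *v ?x - b))\<^sup>2"
    using \<beta>p by (simp add: mult_right_mono)
  moreover have "?\<beta> * (r k)\<^sup>2 = ?\<beta> * (norm (A *v ?x - b))\<^sup>2 + ?\<beta> * (norm (pos_part (g ?x)))\<^sup>2"
    by (simp add: r_sq distrib_left)
  ultimately show ?thesis using Zp unfolding pen_def by linarith
qed

end

section \<open>The square-root schedule and the telescoping sum\<close>

locale dpalm_schedule = dpalm_bounded +
  fixes F\<^sub>m :: real
  assumes \<beta>_eq: "\<And>k. \<beta> k = \<beta> 0 * sqrt (real k + 1)"
    and v_eq: "\<And>k. k \<ge> 1 \<Longrightarrow> v k = v 0 / (sqrt (real k + 1) * (ln (real k + 1))\<^sup>2)"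
    and F\<^sub>m: "\<And>u. u \<in> X \<Longrightarrow> \<bar>f u + real_of_ereal (h u)\<bar> \<le> F\<^sub>m"
begin

lemma \<beta>_Suc: "\<beta> k \<le> \<beta> (Suc k)" "\<beta> (Suc k) \<le> 3 / 2 * \<beta> k"
proof -
  \<comment> \<open>Even at \<open>k = 0\<close> the ratio of consecutive penalties is only the
    square root of 2; 3/2 is a rational bound.\<close>
  have "real k + 2 \<le> (3 / 2 * sqrt (real k + 1))\<^sup>2"
    by (simp add: power_mult_distrib) (simp add: power2_eq_square)
  then have "sqrt (real k + 2) \<le> 3 / 2 * sqrt (real k + 1)"
    by (intro real_le_lsqrt) auto
  then have "\<beta> 0 * sqrt (real k + 2) \<le> \<beta> 0 * (3 / 2 * sqrt (real k + 1))"
    using \<beta>[of 0] by (intro mult_left_mono) auto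
  then show "\<beta> (Suc k) \<le> 3 / 2 * \<beta> k"
    unfolding \<beta>_eq[of k] \<beta>_eq[of "Suc k"] by (simp add: algebra_simps)
  show "\<beta> k \<le> \<beta> (Suc k)"
    unfolding \<beta>_eq[of k] \<beta>_eq[of "Suc k"] using \<beta>[of 0] by (intro mult_left_mono) auto
qed

lemma \<beta>_0_le: "\<beta> 0 \<le> \<beta> k"
  by (induction k) (use \<beta>_Suc(1) order_trans in auto)

lemma r_le_0: "r k \<le> 2 * B\<^sub>p / \<beta> 0"
proof -
  have "\<beta> 0 * r k \<le> \<beta> k * r k" by (intro mult_right_mono \<beta>_0_le r_nonneg)
  also note r_le
  finally show ?thesis using \<beta>[of 0] by (simp add: field_simps)
qed

text \<open>Chosen so that its decrements pay for \<open>M_change\<close>: the first term for the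
  penalty growth, the second for the damped multiplier motion, where \<open>v k / \<beta> k\<close>
  is proportional to \<open>1 / (n ln\<^sup>2 n)\<close> with \<open>n = k + 1\<close>.\<close>

definition pot where
  "pot k = 3 * B\<^sub>p\<^sup>2 / \<beta> k + 4 * B\<^sub>p * (v 0 / \<beta> 0) * ln_potential k"

lemma M_change_potential:
  assumes "1 \<le> k"
  shows "M (Suc k) (x (Suc k)) + pot (Suc k) \<le> M k (x (Suc k)) + pot k"
proof -
  let ?\<beta> = "\<beta> (Suc k)"
  have \<beta>p: "0 < \<beta> k" "0 < ?\<beta>" using \<beta> by auto
  have rk: "r k \<le> 2 * B\<^sub>p / \<beta> k" using r_le[of k] \<beta>p by (simp add: field_simps)
  have "(?\<beta> - \<beta> k) / 2 * (r k)\<^sup>2 \<le> (?\<beta> - \<beta> k) / 2 * (2 * B\<^sub>p / \<beta> k)\<^sup>2"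
    using \<beta>_Suc(1)[of k] rk r_nonneg by (intro mult_left_mono power_mono) auto
  \<comment> \<open>Exposes a telescoping difference of reciprocals; the leftover ratio costs 3/2,
    whence the 3 in \<open>pot\<close>.\<close>
  also have "\<dots> = 2 * B\<^sub>p\<^sup>2 * (1 / \<beta> k - 1 / ?\<beta>) * (?\<beta> / \<beta> k)"
    using \<beta>p by (simp add: power2_eq_square field_simps)
  also have "\<dots> \<le> 2 * B\<^sub>p\<^sup>2 * (1 / \<beta> k - 1 / ?\<beta>) * (3 / 2)"
  proof (intro mult_left_mono mult_nonneg_nonneg)
    show "0 \<le> 1 / \<beta> k - 1 / ?\<beta>"
      using \<beta>_Suc(1)[of k] \<beta>p by (simp add: frac_le)
  qed (use \<beta>_Suc(2)[of k] \<beta>p in \<open>auto simp: field_simps\<close>)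
  finally have 1: "(?\<beta> - \<beta> k) / 2 * (r k)\<^sup>2 \<le> 3 * B\<^sub>p\<^sup>2 / \<beta> k - 3 * B\<^sub>p\<^sup>2 / ?\<beta>"
    by (simp add: algebra_simps)
  have "v k * r k \<le> v k * (2 * B\<^sub>p / \<beta> k)" by (intro mult_left_mono rk v)
  \<comment> \<open>The coefficient is 3/2 * 2 + 1 = 4.\<close>
  then have "3 / 2 * (v k * r k) + v k * B\<^sub>p / \<beta> k \<le> 4 * B\<^sub>p * (v k / \<beta> k)"
    by (simp add: algebra_simps)
  also have "v k / \<beta> k = (v 0 / \<beta> 0) * (1 / ((real k + 1) * (ln (real k + 1))\<^sup>2))"
  proof -
    have "a / (s * l) / (c * s) = a / c * (1 / (s * s * l))" for a s l c :: real
      by (simp add: mult_ac)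
    then show ?thesis unfolding v_eq[OF assms] \<beta>_eq[of k] by simp
  qed
  also have "4 * B\<^sub>p * \<dots> \<le> 4 * B\<^sub>p * ((v 0 / \<beta> 0) * (ln_potential k - ln_potential (Suc k)))"
    using B\<^sub>p_nonneg v[of 0] \<beta>[of 0] ln_potential_telescope[OF assms]
    by (intro mult_left_mono) auto
  finally have "3 / 2 * (v k * r k) + v k * B\<^sub>p / \<beta> k
      \<le> 4 * B\<^sub>p * (v 0 / \<beta> 0) * ln_potential k - 4 * B\<^sub>p * (v 0 / \<beta> 0) * ln_potential (Suc k)"
    by (simp add: algebra_simps)
  then show ?thesis
    using 1 M_change[OF \<beta>_Suc(1), of k] unfolding pot_def by linarith
qed

text \<open>Merit function plus potential telescopes. The coefficient 14 is 9 from the starting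
  value, 3 from the potential and 2 from the lower bound at the end; 12 is 4 times the bound 3 on
  \<open>ln_potential\<close>.\<close>

lemma total_descent:
  assumes K: "1 \<le> K" and \<delta>: "\<And>k. K \<le> k \<Longrightarrow> k < K + n \<Longrightarrow> \<delta> \<le> M k (x k) - M k (x (Suc k))"
  shows "real n * \<delta> \<le> 2 * F\<^sub>m + 14 * B\<^sub>p\<^sup>2 / \<beta> 0 + 12 * B\<^sub>p * (v 0 / \<beta> 0)"
proof -
  have tele: "real n * \<delta> \<le> M K (x K) + pot K - (M (K + n) (x (K + n)) + pot (K + n))"
    using \<delta>
  proof (induction n)
    case (Suc n)
    have "\<delta> \<le> M (K + n) (x (K + n)) - M (K + n) (x (Suc (K + n)))"
      using Suc.prems[of "K + n"] by simp
    moreover have "real n * \<delta> \<le> M K (x K) + pot K - (M (K + n) (x (K + n)) + pot (K + n))"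
      using Suc.prems by (intro Suc.IH) auto
    ultimately show ?case
      using M_change_potential[of "K + n"] K by (simp add: algebra_simps)
  qed simp
  have \<beta>0: "0 < \<beta> 0" using \<beta> .
  have Bpr: "B\<^sub>p * r k \<le> 2 * B\<^sub>p\<^sup>2 / \<beta> 0" for k
    using mult_left_mono[OF r_le_0 B\<^sub>p_nonneg, of k] by (simp add: power2_eq_square mult_ac)
  have over: "c / \<beta> k \<le> c / \<beta> 0" if "0 \<le> c" for c k
    using that \<beta>0 \<beta>_0_le[of k] by (intro divide_left_mono) auto
  \<comment> \<open>A start at 1 or later provides a preceding step, whose residual bounds the
    infeasibility of the starting point; the logarithmic schedule also begins there.\<close>
  obtain j where j: "K = Suc j" using K by (cases K) auto
  have "\<beta> (Suc j) * (r j)\<^sup>2 \<le> 3 / 2 * \<beta> j * (r j)\<^sup>2"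
    by (intro mult_right_mono \<beta>_Suc) auto
  also have "\<dots> = 3 / 2 * (\<beta> j * r j) * r j" by (simp add: power2_eq_square)
  also have "\<dots> \<le> 3 / 2 * (2 * B\<^sub>p) * r j" by (intro mult_right_mono mult_left_mono r_le r_nonneg) auto
  also have "\<dots> \<le> 6 * B\<^sub>p\<^sup>2 / \<beta> 0" using Bpr[of j] by simp
  finally have "pen K (x K) \<le> 9 * B\<^sub>p\<^sup>2 / \<beta> 0"
    using pen_le[of j] Bpr[of j] over[of "B\<^sub>p\<^sup>2" "Suc j"] j by simp
  moreover have "\<bar>f (x K) + real_of_ereal (h (x K))\<bar> \<le> F\<^sub>m" by (intro F\<^sub>m x_in_X)
  ultimately have up: "M K (x K) \<le> F\<^sub>m + 9 * B\<^sub>p\<^sup>2 / \<beta> 0" unfolding M_def by linarith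
  define c where "c = 4 * B\<^sub>p * (v 0 / \<beta> 0)"
  have c: "0 \<le> c" using B\<^sub>p_nonneg v[of 0] \<beta>0 by (simp add: c_def)
  have "c * ln_potential K \<le> c * 3"
    using c K by (intro mult_left_mono ln_potential_bounds) auto
  then have potK: "pot K \<le> 3 * B\<^sub>p\<^sup>2 / \<beta> 0 + 3 * c"
    using over[of "3 * B\<^sub>p\<^sup>2" K] unfolding pot_def c_def[symmetric] by simp
  have pot0: "0 \<le> pot (K + n)"
    unfolding pot_def c_def[symmetric] using c K \<beta>[of "K + n"] ln_potential_bounds(1)[of "K + n"] by simp
  obtain i where i: "K + n = Suc i" using K by (cases "K + n") auto
  have "B\<^sub>p * norm (A *v x (Suc i) - b) \<le> B\<^sub>p * r i"
    by (intro mult_left_mono residual_le_r B\<^sub>p_nonneg)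
  then have "- (2 * B\<^sub>p\<^sup>2 / \<beta> 0) \<le> pen (Suc i) (x (Suc i))"
    using Bpr[of i] pen_ge[of "x (Suc i)" "Suc i"] by linarith
  moreover have "\<bar>f (x (Suc i)) + real_of_ereal (h (x (Suc i)))\<bar> \<le> F\<^sub>m" by (intro F\<^sub>m x_in_X)
  ultimately have low: "- F\<^sub>m - 2 * B\<^sub>p\<^sup>2 / \<beta> 0 \<le> M (K + n) (x (K + n))"
    unfolding M_def i by linarith
  show ?thesis
    using tele up low potK pot0 by (simp add: c_def)
qed

end

subsection \<open>Iteration complexity\<close>

theorem theorem1:
  fixes f :: "real^'d \<Rightarrow> real" and h F :: "real^'d \<Rightarrow> ereal" and X :: "(real^'d) set"
    and A :: "real^'d^'n" and b :: "real^'n" and g :: "real^'d \<Rightarrow> real^'m"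
    and xfeas :: "real^'d" and \<beta> v \<epsilon>s :: "nat \<Rightarrow> real"
    and x :: "nat \<Rightarrow> real^'d" and y :: "nat \<Rightarrow> real^'n" and z :: "nat \<Rightarrow> real^'m"
    and \<rho> L\<^sub>g L\<^sub>f r\<^sub>h B\<^sub>g B\<^sub>f \<epsilon> :: real
    and D gmin d\<^sub>b\<^sub>d \<tau> Bbar \<theta> B\<^sub>p Q C\<^sub>1 C\<^sub>p' C\<^sub>p C\<^sub>x :: real and K\<^sub>1 K\<^sub>2 :: int
  assumes F: "F = (\<lambda>u. ereal (f u) + h u)"
    and X: "X = edom F" "continuous_on X F" "compact X"
    and f_weakly_convex: "\<rho> > 0" "weakly_convex_on \<rho> X f"
    and h: "closed_convex_fun h"
    and g: "\<And>i. \<exists>U. open U \<and> X \<subseteq> U \<and> convex_on U (\<lambda>u. g u $ i) \<and> smooth_on L\<^sub>g U (\<lambda>u. g u $ i)"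
    and gmin: "gmin = Min (range (\<lambda>i. - (g xfeas $ i)))"
    and slater: "xfeas \<in> interior X" "A *v xfeas = b" "gmin > 0"
    and h_subdiff: "r\<^sub>h > 0"
      "\<And>u. u \<in> X \<Longrightarrow> subdiff h u \<noteq> {} \<and> subdiff h u \<subseteq> normal_cone X u + cball 0 r\<^sub>h"
    and f_smooth: "\<exists>U. open U \<and> X \<subseteq> U \<and> smooth_on L\<^sub>f U f"
    and B\<^sub>g: "B\<^sub>g > 0"
      "\<And>u i. u \<in> X \<Longrightarrow> max \<bar>g u $ i\<bar> (norm (grad (\<lambda>w. g w $ i) u)) \<le> B\<^sub>g"
      "\<And>u w i. u \<in> X \<Longrightarrow> w \<in> X \<Longrightarrow> \<bar>g u $ i - g w $ i\<bar> \<le> B\<^sub>g * norm (u - w)"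
    and B\<^sub>f: "B\<^sub>f > 0" "\<And>u. u \<in> X \<Longrightarrow> norm (grad f u) \<le> B\<^sub>f"
    and \<epsilon>: "\<epsilon> > 0"
    and \<beta>: "\<beta> 0 > 0" "\<And>k. k \<ge> 1 \<Longrightarrow> \<beta> k = \<beta> 0 * sqrt (real k + 1)"
    and v: "v 0 > 0" "\<And>k. k \<ge> 1 \<Longrightarrow> v k = v 0 / (sqrt (real k + 1) * (ln (real k + 1))\<^sup>2)"
    and \<epsilon>s: "\<And>k. \<epsilon>s k = Min {\<epsilon> / 8, sqrt (\<rho> / (2 * \<beta> k)), 1}"
    and iterates: "dpalm F A b g \<rho> \<beta> v \<epsilon>s x y z"
    and D: "D = diameter X"
    and d\<^sub>b\<^sub>d: "d\<^sub>b\<^sub>d = infdist xfeas (frontier X)"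
    and \<tau>: "\<tau> = min (gmin / (2 * sqrt (real CARD('m)) * B\<^sub>g)) d\<^sub>b\<^sub>d"
    and Bbar: "Bbar = D * (r\<^sub>h + B\<^sub>f) + 2 * \<rho> * D\<^sup>2 + D + \<tau> * (1 + r\<^sub>h + B\<^sub>f + 2 * \<rho> * D)"
    and \<theta>: "\<theta> = dual_bound A \<tau> gmin Bbar"
    and B\<^sub>p: "B\<^sub>p = max (norm (y 0, z 0)) \<theta>"
    and Q: "Q = D * (B\<^sub>f + 2 * \<rho> * D + r\<^sub>h)"
    and C\<^sub>1: "C\<^sub>1 = 1 / D + 1 / d\<^sub>b\<^sub>d + B\<^sub>g / gmin"
    and C\<^sub>p': "C\<^sub>p' = 2 * (B\<^sub>p + sqrt (Q\<^sup>2 / gmin\<^sup>2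
                 + Q\<^sup>2 * (mat_norm (pinv (A ** transpose A) ** A))\<^sup>2 * C\<^sub>1\<^sup>2)) + 1"
    and C\<^sub>p: "C\<^sub>p = 2 * C\<^sub>p'"
    and C\<^sub>x: "C\<^sub>x = 2 * (SUP u\<in>X. \<bar>real_of_ereal (F u)\<bar>)
                 + 1 / (4 * \<beta> 0) * (14 * C\<^sub>p\<^sup>2 + 8 * B\<^sub>p * C\<^sub>p + 7 * B\<^sub>p\<^sup>2)
                 + (10 * C\<^sub>p + 4 * B\<^sub>p) * (v 0 / \<beta> 0)
                 + \<beta> 0 / 2 * ((norm (A *v x 0 - b))\<^sup>2
                     + (norm (pos_part (g (x 0) + (1 / \<beta> 0) *\<^sub>R z 0)))\<^sup>2)
                 + \<bar>y 0 \<bullet> (A *v x 0 - b)\<bar>"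
    and K\<^sub>1: "K\<^sub>1 = \<lceil>max (C\<^sub>p\<^sup>2 / ((\<beta> 0)\<^sup>2 * \<epsilon>\<^sup>2))
                      ((4 * B\<^sub>p\<^sup>2 + 5 * C\<^sub>p\<^sup>2)\<^sup>2 / (16 * (\<beta> 0)\<^sup>2 * \<epsilon>\<^sup>2))\<rceil>"
    and K\<^sub>2: "K\<^sub>2 = \<lceil>5 * C\<^sub>x * \<rho> / \<epsilon>\<^sup>2\<rceil>"
  shows "\<exists>k. int k < K\<^sub>1 + K\<^sub>2 \<and> eps_kkt F A b g \<rho> \<epsilon> (x (Suc k))"
proof -
  have X_h: "X = edom h" unfolding X(1) F edom_def by auto
  have h_fin: "h u \<noteq> \<infinity>" "h u \<noteq> -\<infinity>" if "u \<in> X" for u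
    using that h by (auto simp: X_h edom_def closed_convex_fun_def)
  have \<beta>_eq: "\<beta> k = \<beta> 0 * sqrt (real k + 1)" for k
    using \<beta>(2)[of k] by (cases "k = 0") auto
  have \<beta>_pos: "\<beta> k > 0" for k using \<beta>(1) by (subst \<beta>_eq) simp
  have v_nonneg: "v k \<ge> 0" for k
    using v by (cases "k = 0") auto
  have D_nonneg: "0 \<le> D"
    unfolding D using compact_imp_bounded[OF X(3)] by (rule diameter_ge_0)
  have d: "cball xfeas d\<^sub>b\<^sub>d \<subseteq> X" "d\<^sub>b\<^sub>d > 0"
    unfolding d\<^sub>b\<^sub>d using cball_infdist_frontier_subset[OF X(3) slater(1)] by auto
  have m1: "1 \<le> sqrt (real CARD('m))" using zero_less_card_finite[where 'a = 'm] by simp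
  have \<tau>_pos: "\<tau> > 0" using m1 slater(3) B\<^sub>g(1) d(2) by (simp add: \<tau>)
  \<comment> \<open>The factor \<open>sqrt m \<ge> 1\<close> in \<tau> is simply dropped: a
    componentwise margin of half \<open>gmin\<close> is enough.\<close>
  have "B\<^sub>g * \<tau> \<le> B\<^sub>g * (gmin / (2 * sqrt (real CARD('m)) * B\<^sub>g))"
    using B\<^sub>g(1) by (intro mult_left_mono) (auto simp: \<tau>)
  also have "\<dots> = gmin / 2 / sqrt (real CARD('m))" using B\<^sub>g(1) by simp
  also have "\<dots> \<le> gmin / 2" using m1 slater(3) by (simp add: field_simps)
  finally have \<tau>_g: "B\<^sub>g * \<tau> \<le> gmin / 2" .
  \<comment> \<open>Restricts constraint convexity from the open neighbourhood to \<open>X\<close>,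
    which is the domain of \<open>h\<close> because \<open>f\<close> is finite everywhere.\<close>
  have X_cvx: "convex X" unfolding X_h by (rule convex_edom[OF h])
  interpret run: dpalm_run f h F X A b g xfeas \<beta> v \<epsilon>s x y z \<rho> r\<^sub>h B\<^sub>g B\<^sub>f gmin \<tau>
  proof
    show "convex_on X (\<lambda>u. g u $ i)" for i
      using g[of i] X_cvx convex_on_subset by blast
    show "(\<lambda>u. g u $ i) differentiable (at u)" if "u \<in> X" for u i
      using g[of i] that unfolding smooth_on_def by blast
    show "f differentiable (at u)" if "u \<in> X" for u
      using f_smooth that unfolding smooth_on_def by blast
    show "cball xfeas \<tau> \<subseteq> X" using d(1) by (force simp: \<tau>)
    show "g xfeas $ i \<le> - gmin" for i
    proof -
      have "gmin \<le> - (g xfeas $ i)" unfolding gmin by (rule Min_le) auto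
      then show ?thesis by simp
    qed
    show "\<epsilon>s k \<le> 1" for k unfolding \<epsilon>s by simp
    show "subdiff h u \<subseteq> normal_cone X u + cball 0 r\<^sub>h" if "u \<in> X" for u
      using h_subdiff(2)[OF that] ..
  qed (fact F X f_weakly_convex h slater h_subdiff(1) B\<^sub>g B\<^sub>f
      \<beta>_pos v_nonneg iterates \<tau>_pos \<tau>_g)+
  \<comment> \<open>\<open>Bbar\<close> exceeds \<open>test_bound\<close> by exactly this
    nonnegative term.\<close>
  have "0 \<le> \<tau> * (1 + r\<^sub>h + B\<^sub>f + 2 * \<rho> * D)"
    using \<tau>_pos h_subdiff(1) B\<^sub>f(1) f_weakly_convex(1) D_nonneg by simp
  then have "run.test_bound \<le> Bbar"
    unfolding run.test_bound_def Bbar D[symmetric] by (simp add: power2_eq_square algebra_simps)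
  note bounded = run.multipliers_bounded[OF \<theta> this B\<^sub>p]
  define F\<^sub>m where "F\<^sub>m = (SUP u\<in>X. \<bar>real_of_ereal (F u)\<bar>)"
  have F_fin: "\<bar>F u\<bar> \<noteq> \<infinity>" if "u \<in> X" for u
    using h_fin[OF that] by (cases "h u") (auto simp: F)
  interpret run: dpalm_schedule f h F X A b g xfeas \<beta> v \<epsilon>s x y z \<rho> r\<^sub>h B\<^sub>g B\<^sub>f gmin \<tau> B\<^sub>p F\<^sub>m
  proof
    show "norm (y k, z k) \<le> B\<^sub>p" "norm (run.Y k, run.Z k) \<le> B\<^sub>p" for k
      by (rule bounded)+
    show "\<bar>f u + real_of_ereal (h u)\<bar> \<le> F\<^sub>m" if u: "u \<in> X" for u
    proof -
      have "real_of_ereal (F u) = f u + real_of_ereal (h u)"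
        using h_fin[OF u] by (cases "h u") (auto simp: F)
      then show ?thesis
        using abs_real_of_ereal_le_SUP[OF X(3,2) F_fin u] by (simp add: F\<^sub>m_def)
    qed
  qed (fact \<beta>_eq v(2))+
  have Bp0: "0 \<le> B\<^sub>p" by (rule run.B\<^sub>p_nonneg)
  have Cp_ge: "4 * B\<^sub>p + 2 \<le> C\<^sub>p" by (simp add: C\<^sub>p C\<^sub>p')
  then have Cp_pos: "0 < C\<^sub>p" using Bp0 by linarith
  have Fm0: "0 \<le> F\<^sub>m" using run.F\<^sub>m[OF run.x_in_X[of 0]] by linarith
  have Cp_sq: "16 * B\<^sub>p\<^sup>2 + 4 \<le> C\<^sub>p\<^sup>2"
  proof -
    have "(4 * B\<^sub>p + 2)\<^sup>2 \<le> C\<^sub>p\<^sup>2" using Cp_ge Bp0 by (intro power_mono) auto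
    then show ?thesis using Bp0 by (simp add: power2_sum power_mult_distrib)
  qed
  have Cx: "2 * F\<^sub>m + 14 * B\<^sub>p\<^sup>2 / \<beta> 0 + 12 * B\<^sub>p * (v 0 / \<beta> 0) \<le> C\<^sub>x" "0 < C\<^sub>x"
  proof -
    have b0: "0 < 1 / (4 * \<beta> 0)" and vb: "0 < v 0 / \<beta> 0" using \<beta>(1) v(1) by auto
    have "56 * B\<^sub>p\<^sup>2 \<le> 14 * C\<^sub>p\<^sup>2 + 8 * B\<^sub>p * C\<^sub>p + 7 * B\<^sub>p\<^sup>2"
    proof -
      have "0 \<le> 8 * B\<^sub>p * C\<^sub>p" using Bp0 Cp_pos by simp
      moreover have "0 \<le> B\<^sub>p\<^sup>2" by simp
      ultimately show ?thesis using Cp_sq by linarith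
    qed
    then have "1 / (4 * \<beta> 0) * (56 * B\<^sub>p\<^sup>2)
        \<le> 1 / (4 * \<beta> 0) * (14 * C\<^sub>p\<^sup>2 + 8 * B\<^sub>p * C\<^sub>p + 7 * B\<^sub>p\<^sup>2)"
      using b0 by (intro mult_left_mono) auto
    moreover have "1 / (4 * \<beta> 0) * (56 * B\<^sub>p\<^sup>2) = 14 * B\<^sub>p\<^sup>2 / \<beta> 0" using \<beta>(1) by simp
    \<comment> \<open>Strict since \<open>v 0 > 0\<close> and
      \<open>C\<^sub>p \<ge> 4 * B\<^sub>p + 2\<close>; this strictness is what makes
      \<open>C\<^sub>x\<close> positive.\<close>
    moreover have "12 * B\<^sub>p * (v 0 / \<beta> 0) < (10 * C\<^sub>p + 4 * B\<^sub>p) * (v 0 / \<beta> 0)"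
      using vb Cp_ge Bp0 by (intro mult_strict_right_mono) linarith+
    moreover have "0 \<le> \<beta> 0 / 2 * ((norm (A *v x 0 - b))\<^sup>2
        + (norm (pos_part (g (x 0) + (1 / \<beta> 0) *\<^sub>R z 0)))\<^sup>2)" using \<beta>(1) by simp
    ultimately have less: "2 * F\<^sub>m + 14 * B\<^sub>p\<^sup>2 / \<beta> 0 + 12 * B\<^sub>p * (v 0 / \<beta> 0) < C\<^sub>x"
      unfolding C\<^sub>x F\<^sub>m_def[symmetric] by linarith
    then show "2 * F\<^sub>m + 14 * B\<^sub>p\<^sup>2 / \<beta> 0 + 12 * B\<^sub>p * (v 0 / \<beta> 0) \<le> C\<^sub>x" by simp
    have "0 \<le> 12 * B\<^sub>p * (v 0 / \<beta> 0)" using vb Bp0 by (intro mult_nonneg_nonneg) auto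
    moreover have "0 \<le> 14 * B\<^sub>p\<^sup>2 / \<beta> 0" using \<beta>(1) by simp
    ultimately show "0 < C\<^sub>x" using less Fm0 by linarith
  qed
  have "0 < C\<^sub>p\<^sup>2 / ((\<beta> 0)\<^sup>2 * \<epsilon>\<^sup>2)" using Cp_pos \<beta>(1) \<epsilon> by simp
  \<comment> \<open>Positivity under the ceiling keeps the telescoping away from index 0, where
    \<open>ln (k + 1)\<close> vanishes.\<close>
  then have K1: "1 \<le> K\<^sub>1" unfolding K\<^sub>1 by (simp add: less_max_iff_disj)
  have K2: "0 \<le> K\<^sub>2" unfolding K\<^sub>2 using Cx(2) f_weakly_convex(1) \<epsilon>
    by (intro zero_le_ceiling[THEN iffD2]) (smt (verit) divide_nonneg_nonneg mult_nonneg_nonneg zero_le_power2)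
  show ?thesis
  proof (rule ccontr)
    assume none: "\<not> ?thesis"
    let ?K = "nat K\<^sub>1" and ?n = "nat K\<^sub>2"
    have \<delta>: "11 / 50 * (\<epsilon>\<^sup>2 / \<rho>) \<le> run.M k (x k) - run.M k (x (Suc k))"
      if k: "?K \<le> k" "k < ?K + ?n" for k
    proof -
      \<comment> \<open>The two entries of the maximum in \<open>K\<^sub>1\<close> are this
        condition for \<open>c = C\<^sub>p\<close> (infeasibility) and
        \<open>c = (4 * B\<^sub>p\<^sup>2 + 5 * C\<^sub>p\<^sup>2) / 4\<close>
        (complementarity).\<close>
      have \<beta>\<epsilon>: "c \<le> \<beta> k * \<epsilon>" if "c\<^sup>2 / ((\<beta> 0)\<^sup>2 * \<epsilon>\<^sup>2) \<le> real_of_int K\<^sub>1" for c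
      proof (rule power2_le_imp_le)
        have "c\<^sup>2 / ((\<beta> 0)\<^sup>2 * \<epsilon>\<^sup>2) \<le> real k + 1" using that k(1) K1 by linarith
        then have "c\<^sup>2 \<le> (real k + 1) * ((\<beta> 0)\<^sup>2 * \<epsilon>\<^sup>2)"
          using \<beta>(1) \<epsilon> by (simp add: divide_le_eq)
        then show "c\<^sup>2 \<le> (\<beta> k * \<epsilon>)\<^sup>2" by (simp add: \<beta>_eq[of k] power_mult_distrib mult_ac)
        show "0 \<le> \<beta> k * \<epsilon>" using \<beta>_pos[of k] \<epsilon> by simp
      qed
      have K1_ge: "max (C\<^sub>p\<^sup>2 / ((\<beta> 0)\<^sup>2 * \<epsilon>\<^sup>2))
          ((4 * B\<^sub>p\<^sup>2 + 5 * C\<^sub>p\<^sup>2)\<^sup>2 / (16 * (\<beta> 0)\<^sup>2 * \<epsilon>\<^sup>2)) \<le> real_of_int K\<^sub>1"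
        unfolding K\<^sub>1 by (rule le_of_int_ceiling)
      have "C\<^sub>p \<le> \<beta> k * \<epsilon>" using K1_ge by (intro \<beta>\<epsilon>) simp
      then have 1: "2 * B\<^sub>p \<le> \<beta> k * \<epsilon>" using Cp_ge Bp0 by linarith
      have "(4 * B\<^sub>p\<^sup>2 + 5 * C\<^sub>p\<^sup>2) / 4 \<le> \<beta> k * \<epsilon>"
        using K1_ge by (intro \<beta>\<epsilon>) (simp add: power_divide mult.assoc)
      moreover have "0 \<le> B\<^sub>p\<^sup>2" by simp
      ultimately have 2: "2 * B\<^sub>p\<^sup>2 \<le> \<beta> k * \<epsilon>" using Cp_sq by argo
      have "int k < K\<^sub>1 + K\<^sub>2" using k K1 K2 by linarith
      then have "\<not> eps_kkt F A b g \<rho> \<epsilon> (x (Suc k))" using none by blast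
      then have "\<epsilon> < \<epsilon>s k + 2 * \<rho> * norm (x (Suc k) - x k)"
        using run.eps_kktI[OF _ 1 2] by linarith
      moreover have "\<epsilon>s k \<le> \<epsilon> / 8" unfolding \<epsilon>s by simp
      ultimately show ?thesis
        using long_step_descent[OF f_weakly_convex(1) \<epsilon>] run.descent[of k] by (meson order_trans)
    qed
    have "5 * C\<^sub>x * \<rho> / \<epsilon>\<^sup>2 \<le> real ?n"
      using le_of_int_ceiling[of "5 * C\<^sub>x * \<rho> / \<epsilon>\<^sup>2"] K2 unfolding K\<^sub>2 by simp
    \<comment> \<open>Since 5 * 11/50 = 11/10 > 1, \<open>K\<^sub>2\<close> long steps would
      together descend by more than the available \<open>C\<^sub>x\<close>.\<close>
    have "11 / 10 * C\<^sub>x = 5 * C\<^sub>x * \<rho> / \<epsilon>\<^sup>2 * (11 / 50 * (\<epsilon>\<^sup>2 / \<rho>))"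
      using f_weakly_convex(1) \<epsilon> by (simp add: field_simps)
    also have "\<dots> \<le> real ?n * (11 / 50 * (\<epsilon>\<^sup>2 / \<rho>))"
      using f_weakly_convex(1) \<open>5 * C\<^sub>x * \<rho> / \<epsilon>\<^sup>2 \<le> real ?n\<close> by (intro mult_right_mono) auto
    also have "\<dots> \<le> C\<^sub>x"
      using run.total_descent[of ?K ?n, OF _ \<delta>] K1 Cx(1) by linarith
    finally show False using Cx(2) by linarith
  qed
qed

end
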